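(* Let $U,V$ be compact metric spaces and let $b:\mathbb{R}^n\times U\times V\to\mathbb{R}^n$, $\sigma:\mathbb{R}^n\times U\times V\to\mathbb{R}^{n\times d}$, $f:\mathbb{R}^n\times U\times V\to\mathbb{R}$ satisfy: (a) for every fixed $x\in\mathbb{R}^n$, $b(x,\cdot,\cdot),\sigma(x,\cdot,\cdot),f(x,\cdot,\cdot)$ are continuous on $U\times V$; (b) there are constants $C_b,C_f,C_\sigma$ such that for all $x,y\in\mathbb{R}^n$, $u\in U$, $v\in V$: $|b(x,u,v)-b(y,u,v)|\le C_b|x-y|$, $|f(x,u,v)-f(y,u,v)|\le C_f|x-y|$, $\|\sigma(x,u,v)-\sigma(y,u,v)\|\le C_\sigma|x-y|$; (c) there is a constant $K>(C_\sigma)^2$ such that $2\langle x-y,b(x,u,v)-b(y,u,v)\rangle\le -K|x-y|^2$ for all $(u,v)\in U\times V$, $x,y\in\mathbb{R}^n$. Then the ergodic Hamilton-Jacobi-Bellman-Isaacs equation $$\rho=\inf_{u\in U}\sup_{v\in V}H(x,Dw(x),D^2w(x),u,v),\quad x\in\mathbb{R}^n,$$ has a viscosity solution $(\rho,w)\in\mathbb{R}\times C(\mathbb{R}^n)$ for which there exists a constant $C>0$ such that for all $x,y\in\mathbb{R}^n$, $$|w(x)-w(y)|\le C|x-y|,\qquad |w(x)|\le C|x|.$$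
   Context: $\|\cdot\|$ is the trace norm of a matrix, $\|A\|^2=\mathrm{tr}(AA^* )$, and $|\cdot|$ the Euclidean norm. $\mathcal{S}(n)$ is the set of symmetric $n\times n$ matrices and the Hamiltonian is, for $(x,p,A,u,v)\in\mathbb{R}^n\times\mathbb{R}^n\times\mathcal{S}(n)\times U\times V$, $$H(x,p,A,u,v)=\tfrac12\mathrm{tr}\big((\sigma\sigma^* )(x,u,v)A\big)+\langle b(x,u,v),p\rangle+f(x,u,v).$$ $C^3_b(\mathbb{R}^n)$ is the set of real-valued functions on $\mathbb{R}^n$ that are continuously differentiable up to third order with bounded derivatives of orders 1 to 3. For $\rho\in\mathbb{R}$ and $w\in C(\mathbb{R}^n)$, the pair $(\rho,w)$ is a viscosity subsolution (resp. supersolution) of the equation if for every $\varphi\in C_b^3(\mathbb{R}^n)$ and every $x\in\mathbb{R}^n$ at which $w-\varphi$ has a local maximum (resp. local minimum), $\rho\le\inf_{u\in U}\sup_{v\in V}H(x,D\varphi(x),D^2\varphi(x),u,v)$ (resp. $\rho\ge\inf_{u\in U}\sup_{v\in V}H(x,D\varphi(x),D^2\varphi(x),u,v)$). It is a viscosity solution if it is both. *)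

theory Defs
  imports "HOL-Analysis.Analysis"
begin

definition trace_norm :: "real ^ 'd ^ 'n \<Rightarrow> real" where
  "trace_norm A = sqrt (trace (A ** transpose A))"

definition gradient :: "(real ^ 'n \<Rightarrow> real) \<Rightarrow> real ^ 'n \<Rightarrow> real ^ 'n" where
  "gradient \<phi> x = (\<chi> i. frechet_derivative \<phi> (at x) (axis i 1))"

definition hessian :: "(real ^ 'n \<Rightarrow> real) \<Rightarrow> real ^ 'n \<Rightarrow> real ^ 'n ^ 'n" where
  "hessian \<phi> x = jacobian (gradient \<phi>) (at x)"

(* Only the derivatives of orders 1 to 3 are bounded; the function itself need not be. *)
definition C3b :: "('a::real_normed_vector \<Rightarrow> real) set" where
  "C3b = {\<phi>. \<exists>(D1 :: 'a \<Rightarrow> 'a \<Rightarrow>\<^sub>L real)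
               (D2 :: 'a \<Rightarrow> 'a \<Rightarrow>\<^sub>L ('a \<Rightarrow>\<^sub>L real))
               (D3 :: 'a \<Rightarrow> 'a \<Rightarrow>\<^sub>L ('a \<Rightarrow>\<^sub>L ('a \<Rightarrow>\<^sub>L real))).
            (\<forall>x. (\<phi> has_derivative blinfun_apply (D1 x)) (at x)) \<and>
            (\<forall>x. (D1 has_derivative blinfun_apply (D2 x)) (at x)) \<and>
            (\<forall>x. (D2 has_derivative blinfun_apply (D3 x)) (at x)) \<and>
            continuous_on UNIV D3 \<and>
            bounded (range D1) \<and> bounded (range D2) \<and> bounded (range D3)}"

(* The matrix argument A is meant to be symmetric; below only Hessians of C^3 functions,
   which are symmetric, are substituted for it. *)
definition hamiltonian ::
  "(real ^ 'n \<Rightarrow> 'u \<Rightarrow> 'v \<Rightarrow> real ^ 'n) \<Rightarrow> (real ^ 'n \<Rightarrow> 'u \<Rightarrow> 'v \<Rightarrow> real ^ 'd ^ 'n) \<Rightarrow>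
   (real ^ 'n \<Rightarrow> 'u \<Rightarrow> 'v \<Rightarrow> real) \<Rightarrow>
   real ^ 'n \<Rightarrow> real ^ 'n \<Rightarrow> real ^ 'n ^ 'n \<Rightarrow> 'u \<Rightarrow> 'v \<Rightarrow> real" where
  "hamiltonian b \<sigma> f x p A u v =
     1/2 * trace ((\<sigma> x u v ** transpose (\<sigma> x u v)) ** A) + b x u v \<bullet> p + f x u v"

(* H is the Hamiltonian; INF and SUP are those of the reals, so they carry their usual meaning
   only for nonempty U and V and bounded ranges. *)
definition viscosity_subsolution ::
  "'u set \<Rightarrow> 'v set \<Rightarrow> (real ^ 'n \<Rightarrow> real ^ 'n \<Rightarrow> real ^ 'n ^ 'n \<Rightarrow> 'u \<Rightarrow> 'v \<Rightarrow> real) \<Rightarrow>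
   real \<Rightarrow> (real ^ 'n \<Rightarrow> real) \<Rightarrow> bool" where
  "viscosity_subsolution U V H \<rho> w \<longleftrightarrow>
     (\<forall>\<phi>\<in>C3b. \<forall>x. (\<forall>\<^sub>F y in nhds x. w y - \<phi> y \<le> w x - \<phi> x) \<longrightarrow>
        \<rho> \<le> (INF u\<in>U. SUP v\<in>V. H x (gradient \<phi> x) (hessian \<phi> x) u v))"

definition viscosity_supersolution ::
  "'u set \<Rightarrow> 'v set \<Rightarrow> (real ^ 'n \<Rightarrow> real ^ 'n \<Rightarrow> real ^ 'n ^ 'n \<Rightarrow> 'u \<Rightarrow> 'v \<Rightarrow> real) \<Rightarrow>
   real \<Rightarrow> (real ^ 'n \<Rightarrow> real) \<Rightarrow> bool" where
  "viscosity_supersolution U V H \<rho> w \<longleftrightarrow>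
     (\<forall>\<phi>\<in>C3b. \<forall>x. (\<forall>\<^sub>F y in nhds x. w y - \<phi> y \<ge> w x - \<phi> x) \<longrightarrow>
        \<rho> \<ge> (INF u\<in>U. SUP v\<in>V. H x (gradient \<phi> x) (hessian \<phi> x) u v))"

definition viscosity_solution ::
  "'u set \<Rightarrow> 'v set \<Rightarrow> (real ^ 'n \<Rightarrow> real ^ 'n \<Rightarrow> real ^ 'n ^ 'n \<Rightarrow> 'u \<Rightarrow> 'v \<Rightarrow> real) \<Rightarrow>
   real \<Rightarrow> (real ^ 'n \<Rightarrow> real) \<Rightarrow> bool" where
  "viscosity_solution U V H \<rho> w \<longleftrightarrow>
     viscosity_subsolution U V H \<rho> w \<and> viscosity_supersolution U V H \<rho> w"

end

theory Submission
  imports Defs "HOL-Complex_Analysis.Great_Picard"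
begin

text \<open>
  The solution is obtained as a limit of monotone finite-difference schemes, which avoids any
  comparison principle for the degenerate second-order equation. For a step \<open>h\<close> the diffusion is
  replaced by one move of a random walk: from \<open>x\<close> under the control pair \<open>(u, v)\<close> go to
  \<open>x + h b \<plusminus> sqrt (d h) \<sigma>\<^sub>j\<close>, where the sign and the column \<open>\<sigma>\<^sub>j\<close> of \<open>\<sigma>\<close> are
  uniformly distributed. The scheme operator maps \<open>w\<close> to the inf-sup over \<open>(u, v)\<close> of the mean of
  the discounted function \<open>(1 - h\<^sup>2) w\<close> over the new positions, plus \<open>h f\<close>.

  Moving two walks with the same sign, column and controls, dissipativity and \<open>K > C\<^sub>\<sigma>\<^sup>2\<close> make
  their mean distance shrink by a factor \<open>1 - h \<kappa>\<close>, where
  \<open>\<kappa> = (K - C\<^sub>\<sigma>\<^sup>2) / 4\<close> (lemma \<open>walk_coupling\<close>). As the reward changes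
  by at most \<open>h C\<^sub>f |x - y|\<close> per step, functions with Lipschitz constant \<open>C\<^sub>f / \<kappa>\<close> are mapped to
  such functions, for every small \<open>h\<close>. The mean of \<open>|y|\<^sup>2\<close> over the new positions is computed exactly
  and shows that \<open>\<plusminus> (|x|\<^sup>2 + c / h)\<close> are barriers (lemma \<open>step_barrier_class\<close>). The functions
  satisfying both bounds form a set closed under suprema and infima, on which the monotone operator
  has a fixed point by the argument of Knaster and Tarski. Subtracting its value at the origin
  gives \<open>v\<close> and a bounded number \<open>r\<close> with \<open>v + h r\<close> equal to the scheme operator applied to \<open>v\<close>
  (lemma \<open>discrete_ergodic_solution\<close>).

  The Lipschitz bound does not depend on \<open>h\<close>, so along a sequence \<open>h \<rightarrow> 0\<close> the functions \<open>v\<close> converge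
  locally uniformly to some \<open>w\<close> and the numbers \<open>r\<close> to some \<open>\<rho>\<close>. That \<open>(\<rho>, w)\<close> is a viscosity
  solution follows from monotonicity and consistency (lemmas \<open>limit_subsolution_strict\<close>
  and \<open>limit_subsolution\<close>): by Taylor's
  formula a smooth test function may be replaced by a quadratic polynomial, for which the mean over
  the walk is again exact.

  Of the inf-sup only three properties enter, namely monotonicity, compatibility with additive
  constants and positive homogeneity. They are inherited by the dual functional
  \<open>F \<mapsto> - G (- F)\<close>, and therefore the supersolution half is the subsolution half of the
  game with reward \<open>- f\<close> and solution \<open>- w\<close>.
\<close>


section \<open>Second-order expansions of test functions\<close>

text \<open>
  Mean value theorem for \<open>\<phi>\<close> minus its expansion along the segment from \<open>x\<close> to \<open>y\<close>: the
  derivative of this difference at time \<open>t\<close> is the error of the linearization of \<open>D1\<close> at \<open>x\<close>, applied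
  to \<open>y - x\<close>.
\<close>

lemma second_order_taylor:
  fixes \<phi> :: "'a::real_normed_vector \<Rightarrow> real"
  assumes D1: "\<And>x. (\<phi> has_derivative blinfun_apply (D1 x)) (at x)"
    and D2: "(D1 has_derivative blinfun_apply D2) (at x)" and \<eta>: "\<eta> > 0"
  obtains r where "r > 0"
    "\<And>y. norm (y - x) \<le> r \<Longrightarrow>
       \<bar>\<phi> y - \<phi> x - D1 x (y - x) - D2 (y - x) (y - x) / 2\<bar> \<le> \<eta> * (norm (y - x))\<^sup>2"
proof -
  obtain d where d: "d > 0" and d_le: "\<And>y. norm (y - x) < d \<Longrightarrow> norm (D1 y - D1 x - D2 (y - x)) \<le> \<eta> * norm (y - x)"
    using D2 \<eta> unfolding has_derivative_at_alt by blast
  have "\<bar>\<phi> y - \<phi> x - D1 x (y - x) - D2 (y - x) (y - x) / 2\<bar> \<le> \<eta> * (norm (y - x))\<^sup>2"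
    if y: "norm (y - x) \<le> d / 2" for y
  proof -
    define z where "z = y - x"
    define g where "g = (\<lambda>t::real. \<phi> (x + t *\<^sub>R z) - t * D1 x z - t\<^sup>2 / 2 * D2 z z)"
    have g': "(g has_derivative (\<lambda>k. k * (D1 (x + t *\<^sub>R z) z - D1 x z - t * D2 z z))) (at t within {0..1})" for t
      unfolding g_def
      by (rule derivative_eq_intros has_derivative_compose[OF _ D1] refl | simp)+
         (auto simp: fun_eq_iff algebra_simps blinfun.scaleR_right)
    obtain t where "t \<in> {0<..<1}"
        and g_diff: "g 1 - g 0 = (1 - 0) * (D1 (x + t *\<^sub>R z) z - D1 x z - t * D2 z z)"
      using mvt_simple[OF zero_less_one g'] by blast
    then have t: "0 < t" "t < 1" by simp_all
    have eq: "g 1 - g 0 = D1 (x + t *\<^sub>R z) z - D1 x z - t * D2 z z"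
      using g_diff by (simp only: diff_zero mult_1)
    have tz: "norm (t *\<^sub>R z) \<le> norm z" using t by (simp add: mult_left_le_one_le)
    have "norm (D1 (x + t *\<^sub>R z) - D1 x - D2 (t *\<^sub>R z)) \<le> \<eta> * norm (t *\<^sub>R z)"
    proof -
      have "norm (t *\<^sub>R z) < d" using tz y d unfolding z_def[symmetric] by linarith
      then show ?thesis using d_le[of "x + t *\<^sub>R z"] by (simp only: add_diff_cancel_left')
    qed
    also have "\<dots> \<le> \<eta> * norm z" using tz \<eta> by (intro mult_left_mono) auto
    finally have "norm ((D1 (x + t *\<^sub>R z) - D1 x - D2 (t *\<^sub>R z)) z) \<le> \<eta> * norm z * norm z"
      by (meson norm_blinfun order_trans mult_right_mono norm_ge_zero)
    moreover have "(D1 (x + t *\<^sub>R z) - D1 x - D2 (t *\<^sub>R z)) z = g 1 - g 0"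
      unfolding eq by (simp add: blinfun.diff_left blinfun.scaleR_left blinfun.scaleR_right)
    moreover have "g 1 - g 0 = \<phi> y - \<phi> x - D1 x (y - x) - D2 (y - x) (y - x) / 2"
      by (simp add: g_def z_def)
    ultimately show ?thesis by (simp add: z_def power2_eq_square mult.assoc)
  qed
  with d that[of "d / 2"] show thesis by auto
qed

lemma C3b_taylor:
  fixes \<phi> :: "real ^ 'n \<Rightarrow> real"
  assumes \<phi>: "\<phi> \<in> C3b" and \<eta>: "\<eta> > 0"
  obtains r where "r > 0"
    "\<And>y. norm (y - x) \<le> r \<Longrightarrow>
       \<bar>\<phi> y - \<phi> x - gradient \<phi> x \<bullet> (y - x) - (y - x) \<bullet> (hessian \<phi> x *v (y - x)) / 2\<bar>
         \<le> \<eta> * (norm (y - x))\<^sup>2"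
proof -
  obtain D1 D2 where D1: "\<And>x. (\<phi> has_derivative blinfun_apply (D1 x)) (at x)"
      and D2: "\<And>x. (D1 has_derivative blinfun_apply (D2 x)) (at x)"
    using \<phi> unfolding C3b_def by blast
  have basis: "(\<Sum>i\<in>UNIV. z $ i *\<^sub>R axis i 1) = z" for z :: "real ^ 'n"
    by (simp add: basis_expansion scalar_mult_eq_scaleR[symmetric])
  have grad: "gradient \<phi> = (\<lambda>y. \<chi> i. D1 y (axis i 1))"
    using frechet_derivative_at[OF D1] by (simp add: gradient_def fun_eq_iff)
  have D1_eq: "gradient \<phi> x \<bullet> z = D1 x z" for z
  proof -
    have "gradient \<phi> x \<bullet> z = D1 x (\<Sum>i\<in>UNIV. z $ i *\<^sub>R axis i 1)"
      by (simp add: grad blinfun.sum_right blinfun.scaleR_right inner_vec_def mult.commute)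
    then show ?thesis by (simp only: basis)
  qed
  have d: "(gradient \<phi> has_derivative (\<lambda>y. \<chi> i. D2 x y (axis i 1))) (at x)"
    unfolding grad
    by (subst has_derivative_componentwise_within)
       (auto simp: Basis_vec_def inner_axis intro!: bounded_linear.has_derivative[OF _ D2] bounded_linear_intros)
  have D2_eq: "z \<bullet> (hessian \<phi> x *v z) = D2 x z z" for z
  proof -
    have "hessian \<phi> x *v z = (\<chi> i. D2 x z (axis i 1))"
      unfolding hessian_def jacobian_def frechet_derivative_at[OF d, symmetric]
      using has_derivative_linear[OF d] by (simp add: matrix_works)
    then have "z \<bullet> (hessian \<phi> x *v z) = D2 x z (\<Sum>i\<in>UNIV. z $ i *\<^sub>R axis i 1)"
      by (simp add: blinfun.sum_right blinfun.scaleR_right inner_vec_def)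
    then show ?thesis by (simp only: basis)
  qed
  show thesis
    by (rule second_order_taylor[OF D1 D2[of x] \<eta>]) (rule that; simp add: D1_eq D2_eq)
qed

text \<open>
  Near a contact point the test function may be exchanged for a quadratic polynomial, at the price of
  the term \<open>\<eta> |y - x|\<^sup>2\<close>. On quadratic polynomials the mean over the random walk is known exactly.
\<close>

lemma C3b_expansion_above:
  assumes \<phi>: "\<phi> \<in> C3b" and max: "\<forall>\<^sub>F y in nhds x. w y - \<phi> y \<le> w x - \<phi> x" and \<eta>: "\<eta> > 0"
  shows "\<exists>\<delta>>0. \<forall>y. norm (y - x) \<le> \<delta> \<longrightarrow> w y \<le> w x + gradient \<phi> x \<bullet> (y - x)
           + (y - x) \<bullet> (hessian \<phi> x *v (y - x)) / 2 + \<eta> * (norm (y - x))\<^sup>2"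
proof -
  obtain r where r: "r > 0" and le: "\<And>y. norm (y - x) \<le> r \<Longrightarrow>
       \<bar>\<phi> y - \<phi> x - gradient \<phi> x \<bullet> (y - x) - (y - x) \<bullet> (hessian \<phi> x *v (y - x)) / 2\<bar>
         \<le> \<eta> * (norm (y - x))\<^sup>2"
    by (rule C3b_taylor[OF \<phi> \<eta>, where x = x]) blast
  obtain e where e: "0 < e" "\<And>y. norm (y - x) < e \<Longrightarrow> w y - \<phi> y \<le> w x - \<phi> x"
    using max by (auto simp: eventually_nhds_metric dist_norm)
  show ?thesis
  proof (intro exI[of _ "min r (e / 2)"] conjI allI impI)
    fix y assume "norm (y - x) \<le> min r (e / 2)"
    then show "w y \<le> w x + gradient \<phi> x \<bullet> (y - x)
           + (y - x) \<bullet> (hessian \<phi> x *v (y - x)) / 2 + \<eta> * (norm (y - x))\<^sup>2"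
      using le[of y] e(2)[of y] e(1) by linarith
  qed (use r e in simp)
qed

lemma C3b_expansion_below:
  assumes \<phi>: "\<phi> \<in> C3b" and min: "\<forall>\<^sub>F y in nhds x. w y - \<phi> y \<ge> w x - \<phi> x" and \<eta>: "\<eta> > 0"
  shows "\<exists>\<delta>>0. \<forall>y. norm (y - x) \<le> \<delta> \<longrightarrow> w y \<ge> w x + gradient \<phi> x \<bullet> (y - x)
           + (y - x) \<bullet> (hessian \<phi> x *v (y - x)) / 2 - \<eta> * (norm (y - x))\<^sup>2"
proof -
  obtain r where r: "r > 0" and le: "\<And>y. norm (y - x) \<le> r \<Longrightarrow>
       \<bar>\<phi> y - \<phi> x - gradient \<phi> x \<bullet> (y - x) - (y - x) \<bullet> (hessian \<phi> x *v (y - x)) / 2\<bar>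
         \<le> \<eta> * (norm (y - x))\<^sup>2"
    by (rule C3b_taylor[OF \<phi> \<eta>, where x = x]) blast
  obtain e where e: "0 < e" "\<And>y. norm (y - x) < e \<Longrightarrow> w y - \<phi> y \<ge> w x - \<phi> x"
    using min by (auto simp: eventually_nhds_metric dist_norm)
  show ?thesis
  proof (intro exI[of _ "min r (e / 2)"] conjI allI impI)
    fix y assume "norm (y - x) \<le> min r (e / 2)"
    then show "w y \<ge> w x + gradient \<phi> x \<bullet> (y - x)
           + (y - x) \<bullet> (hessian \<phi> x *v (y - x)) / 2 - \<eta> * (norm (y - x))\<^sup>2"
      using le[of y] e(2)[of y] e(1) by linarith
  qed (use r e in simp)
qed

section \<open>Matrix notation and the inf-sup functional\<close>

lemma trace_norm_eq_norm: "trace_norm A = norm (transpose A)"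
proof -
  have "trace (A ** transpose A) = (\<Sum>i\<in>UNIV. \<Sum>j\<in>UNIV. (A $ i $ j)\<^sup>2)"
    by (simp add: trace_def matrix_matrix_mult_def transpose_def power2_eq_square)
  also have "\<dots> = (\<Sum>j\<in>UNIV. \<Sum>i\<in>UNIV. (A $ i $ j)\<^sup>2)" by (rule sum.swap)
  also have "\<dots> = transpose A \<bullet> transpose A"
    by (simp add: inner_vec_def transpose_def power2_eq_square)
  finally show ?thesis by (simp add: trace_norm_def norm_eq_sqrt_inner)
qed

lemma norm_transpose: "norm (transpose A) = norm (A :: real ^ 'd ^ 'n)"
proof -
  have "transpose A \<bullet> transpose A = (\<Sum>j\<in>UNIV. \<Sum>i\<in>UNIV. A $ i $ j * A $ i $ j)"
    by (simp add: inner_vec_def transpose_def)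
  also have "\<dots> = A \<bullet> A" by (subst sum.swap) (simp add: inner_vec_def)
  finally show ?thesis by (simp add: norm_eq_sqrt_inner)
qed

text \<open>
  This turns the second-order term of the Hamiltonian into a sum of quadratic forms of the columns,
  the shape in which it arises from the random walk.
\<close>

lemma trace_covariance:
  fixes S :: "real ^ 'd ^ 'n"
  shows "trace ((S ** transpose S) ** A) = (\<Sum>j\<in>UNIV. transpose S $ j \<bullet> (A *v transpose S $ j))"
proof -
  have "trace ((S ** transpose S) ** A)
      = (\<Sum>i\<in>UNIV. \<Sum>k\<in>UNIV. \<Sum>j\<in>UNIV. S $ i $ j * S $ k $ j * A $ k $ i)"
    by (simp add: trace_def matrix_matrix_mult_def transpose_def sum_distrib_right)
  also have "\<dots> = (\<Sum>k\<in>UNIV. \<Sum>i\<in>UNIV. \<Sum>j\<in>UNIV. S $ i $ j * S $ k $ j * A $ k $ i)"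
    by (rule sum.swap)
  also have "\<dots> = (\<Sum>k\<in>UNIV. \<Sum>j\<in>UNIV. \<Sum>i\<in>UNIV. S $ i $ j * S $ k $ j * A $ k $ i)"
    by (rule sum.cong[OF refl]) (rule sum.swap)
  also have "\<dots> = (\<Sum>j\<in>UNIV. \<Sum>k\<in>UNIV. \<Sum>i\<in>UNIV. S $ i $ j * S $ k $ j * A $ k $ i)"
    by (rule sum.swap)
  also have "\<dots> = (\<Sum>j\<in>UNIV. transpose S $ j \<bullet> (A *v transpose S $ j))"
    by (simp add: inner_vec_def matrix_vector_mult_def transpose_def sum_distrib_left algebra_simps)
  finally show ?thesis .
qed

definition upper_value :: "'u set \<Rightarrow> 'v set \<Rightarrow> ('u \<times> 'v \<Rightarrow> real) \<Rightarrow> real" where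
  "upper_value U V F = (INF u\<in>U. SUP v\<in>V. F (u, v))"

text \<open>
  The factor \<open>t\<close> is there so that homogeneity follows by using the lemma for \<open>t\<close> and for
  \<open>1 / t\<close>.
\<close>

lemma upper_value_le:
  assumes ne: "U \<noteq> {}" "V \<noteq> {}"
    and bd: "bounded (F ` (U \<times> V))" "bounded (F' ` (U \<times> V))"
    and t: "0 < t" and le: "\<And>a. a \<in> U \<times> V \<Longrightarrow> F a \<le> t * F' a + c"
  shows "upper_value U V F \<le> t * upper_value U V F' + c"
proof -
  obtain M where M: "\<And>a. a \<in> U \<times> V \<Longrightarrow> \<bar>F a\<bar> \<le> M"
    using bd(1) unfolding bounded_iff by auto
  obtain M' where M': "\<And>a. a \<in> U \<times> V \<Longrightarrow> \<bar>F' a\<bar> \<le> M'"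
    using bd(2) unfolding bounded_iff by auto
  have above: "bdd_above ((\<lambda>v. F (u, v)) ` V)" "bdd_above ((\<lambda>v. F' (u, v)) ` V)" if "u \<in> U" for u
  proof -
    show "bdd_above ((\<lambda>v. F (u, v)) ` V)"
      by (rule bdd_aboveI2[of V _ M], rule abs_le_D1, rule M) (simp add: that)
    show "bdd_above ((\<lambda>v. F' (u, v)) ` V)"
      by (rule bdd_aboveI2[of V _ M'], rule abs_le_D1, rule M') (simp add: that)
  qed
  obtain v0 where v0: "v0 \<in> V" using ne by auto
  have below: "bdd_below ((\<lambda>u. SUP v\<in>V. F (u, v)) ` U)"
  proof (rule bdd_belowI[where m="- M"], elim imageE)
    fix z u assume u: "u \<in> U" and z: "z = (SUP v\<in>V. F (u, v))"
    have "- M \<le> F (u, v0)" using M[of "(u, v0)"] u v0 by (simp add: abs_le_iff)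
    also have "\<dots> \<le> z" unfolding z by (rule cSUP_upper[OF v0 above(1)[OF u]])
    finally show "- M \<le> z" .
  qed
  have "(upper_value U V F - c) / t \<le> upper_value U V F'"
    unfolding upper_value_def[of U V F']
  proof (rule cINF_greatest[OF ne(1)])
    fix u assume u: "u \<in> U"
    have "upper_value U V F \<le> (SUP v\<in>V. F (u, v))"
      unfolding upper_value_def by (rule cINF_lower[OF below u])
    also have "\<dots> \<le> t * (SUP v\<in>V. F' (u, v)) + c"
    proof (rule cSUP_least[OF ne(2)])
      fix v assume v: "v \<in> V"
      have "F (u, v) \<le> t * F' (u, v) + c" using u v by (intro le) auto
      also have "\<dots> \<le> t * (SUP v\<in>V. F' (u, v)) + c"
        using t cSUP_upper[OF v above(2)[OF u]] by (simp add: mult_left_mono)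
      finally show "F (u, v) \<le> t * (SUP v\<in>V. F' (u, v)) + c" .
    qed
    finally show "(upper_value U V F - c) / t \<le> (SUP v\<in>V. F' (u, v))"
      using t by (simp add: field_simps)
  qed
  then show ?thesis using t by (simp add: field_simps)
qed

lemma upper_value_scale:
  assumes ne: "U \<noteq> {}" "V \<noteq> {}" and bd: "bounded (F ` (U \<times> V))" and t: "0 < t"
  shows "upper_value U V (\<lambda>a. t * F a) = t * upper_value U V F"
proof (rule antisym)
  have bd': "bounded ((\<lambda>a. t * F a) ` (U \<times> V))"
    using bounded_scaling[OF bd, of t] by (simp add: image_image)
  show "upper_value U V (\<lambda>a. t * F a) \<le> t * upper_value U V F"
    using upper_value_le[OF ne bd' bd t, of 0] by simp
  have "upper_value U V F \<le> inverse t * upper_value U V (\<lambda>a. t * F a) + 0"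
    using t by (intro upper_value_le[OF ne bd bd']) (auto simp: field_simps)
  then show "t * upper_value U V F \<le> upper_value U V (\<lambda>a. t * F a)"
    using t by (simp add: field_simps)
qed

section \<open>Averages over a symmetric random walk\<close>

text \<open>
  The step length \<open>sqrt (d h)\<close>, with \<open>d\<close> the number of columns, compensates for choosing only one
  column at a time: the covariance of the increment is \<open>h\<close> times the sum of
  \<open>S\<^sub>j S\<^sub>j\<^sup>T\<close> over \<open>j\<close>.
\<close>

definition walk_mean :: "real \<Rightarrow> ('a::euclidean_space \<Rightarrow> real) \<Rightarrow> 'a \<Rightarrow> 'a ^ 'd \<Rightarrow> real" where
  "walk_mean h w e S =
     (\<Sum>j\<in>UNIV. w (e + sqrt (real CARD('d) * h) *\<^sub>R S $ j) + w (e - sqrt (real CARD('d) * h) *\<^sub>R S $ j))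
       / (2 * real CARD('d))"

text \<open>
  Three base points occur because in the coupling argument two walks and their difference move
  simultaneously, with the same sign and the same column.
\<close>

lemma walk_mean_le_add:
  fixes S S' S'' :: "'a::euclidean_space ^ 'd"
  assumes "\<And>j c. \<bar>c\<bar> = sqrt (real CARD('d) * h) \<Longrightarrow>
             w (e + c *\<^sub>R S $ j) \<le> w' (e' + c *\<^sub>R S' $ j) + w'' (e'' + c *\<^sub>R S'' $ j)"
    and "h \<ge> 0"
  shows "walk_mean h w e S \<le> walk_mean h w' e' S' + walk_mean h w'' e'' S''"
proof -
  let ?t = "sqrt (real CARD('d) * h)"
  have "w (e + ?t *\<^sub>R S $ j) + w (e - ?t *\<^sub>R S $ j)
      \<le> (w' (e' + ?t *\<^sub>R S' $ j) + w' (e' - ?t *\<^sub>R S' $ j))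
        + (w'' (e'' + ?t *\<^sub>R S'' $ j) + w'' (e'' - ?t *\<^sub>R S'' $ j))" for j
    using assms(1)[of ?t j] assms(1)[of "- ?t" j] assms(2) by simp
  then show ?thesis
    unfolding walk_mean_def add_divide_distrib[symmetric] sum.distrib[symmetric]
    by (intro divide_right_mono sum_mono) auto
qed

lemma walk_mean_le:
  fixes S :: "'a::euclidean_space ^ 'd"
  assumes "\<And>j c. \<bar>c\<bar> = sqrt (real CARD('d) * h) \<Longrightarrow> w (e + c *\<^sub>R S $ j) \<le> w' (e + c *\<^sub>R S $ j)"
    and "h \<ge> 0"
  shows "walk_mean h w e S \<le> walk_mean h w' e S"
  using walk_mean_le_add[of h w e S w' e S "\<lambda>_. 0" e S] assms by (simp add: walk_mean_def)

lemma walk_mean_add: "walk_mean h (\<lambda>y. w y + w' y) e S = walk_mean h w e S + walk_mean h w' e S"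
  by (simp add: walk_mean_def sum.distrib add_divide_distrib algebra_simps)

lemma walk_mean_cmult: "walk_mean h (\<lambda>y. c * w y) e S = c * walk_mean h w e S"
proof -
  have "(\<Sum>j\<in>UNIV. c * w (e + sqrt (real CARD('b) * h) *\<^sub>R S $ j) + c * w (e - sqrt (real CARD('b) * h) *\<^sub>R S $ j))
     = c * (\<Sum>j\<in>UNIV. w (e + sqrt (real CARD('b) * h) *\<^sub>R S $ j) + w (e - sqrt (real CARD('b) * h) *\<^sub>R S $ j))"
    by (simp only: sum_distrib_left distrib_left)
  then show ?thesis by (simp add: walk_mean_def)
qed

lemma walk_mean_const: "walk_mean h (\<lambda>_. c) e S = c"
  by (simp add: walk_mean_def)

lemma walk_mean_linear:
  assumes "\<And>x y. g (x + y) = g x + g y" "\<And>r x. g (r *\<^sub>R x) = r * g x"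
  shows "walk_mean h g e S = g e"
proof -
  have "g (e - r *\<^sub>R x) = g e - r * g x" for r x
    using assms(1)[of e "(-r) *\<^sub>R x"] assms(2)[of "-r" x] by simp
  then show ?thesis by (simp add: walk_mean_def assms)
qed

text \<open>
  The terms that are odd in the sign cancel, so the expansion has no remainder. This exactness
  replaces a Taylor expansion of the scheme.
\<close>

lemma walk_mean_quadratic:
  fixes S :: "'a::euclidean_space ^ 'd"
  assumes Q: "bounded_bilinear (Q :: 'a \<Rightarrow> 'a \<Rightarrow> real)" and h: "h \<ge> 0"
  shows "walk_mean h (\<lambda>y. Q (y - c) (y - c)) e S = Q (e - c) (e - c) + h * (\<Sum>j\<in>UNIV. Q (S $ j) (S $ j))"
proof -
  interpret Q: bounded_bilinear Q by (rule Q)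
  let ?t = "sqrt (real CARD('d) * h)"
  have t: "?t * ?t = real CARD('d) * h" using h by simp
  have "Q (e + ?t *\<^sub>R s - c) (e + ?t *\<^sub>R s - c) + Q (e - ?t *\<^sub>R s - c) (e - ?t *\<^sub>R s - c)
      = 2 * Q (e - c) (e - c) + 2 * (real CARD('d) * h) * Q s s" for s
  proof -
    define z where "z = e - c"
    have "Q (e + ?t *\<^sub>R s - c) (e + ?t *\<^sub>R s - c) + Q (e - ?t *\<^sub>R s - c) (e - ?t *\<^sub>R s - c)
      = Q (z + ?t *\<^sub>R s) (z + ?t *\<^sub>R s) + Q (z - ?t *\<^sub>R s) (z - ?t *\<^sub>R s)"
      by (simp add: z_def algebra_simps)
    also have "\<dots> = 2 * Q z z + 2 * (?t * ?t) * Q s s"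
      by (simp only: Q.add_left Q.add_right Q.diff_left Q.diff_right Q.scaleR_left Q.scaleR_right)
         (simp add: algebra_simps)
    finally show ?thesis by (simp only: t z_def)
  qed
  then have "walk_mean h (\<lambda>y. Q (y - c) (y - c)) e S
     = (\<Sum>j\<in>UNIV. 2 * Q (e - c) (e - c) + 2 * (real CARD('d) * h) * Q (S $ j) (S $ j)) / (2 * real CARD('d))"
    by (simp add: walk_mean_def)
  also have "\<dots> = Q (e - c) (e - c) + h * (\<Sum>j\<in>UNIV. Q (S $ j) (S $ j))"
    by (simp add: sum.distrib field_simps flip: sum_distrib_left)
  finally show ?thesis .
qed

lemma walk_mean_norm_square:
  fixes S :: "'a::euclidean_space ^ 'd"
  assumes "h \<ge> 0"
  shows "walk_mean h (\<lambda>y. (norm y)\<^sup>2) e S = (norm e)\<^sup>2 + h * (norm S)\<^sup>2"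
  using walk_mean_quadratic[OF bounded_bilinear_inner assms, of 0 e S]
  by (simp add: power2_norm_eq_inner inner_vec_def)

text \<open>
  Jensen's inequality: with \<open>m\<close> the mean of the norm, average \<open>2 m |y| \<le> m\<^sup>2 + |y|\<^sup>2\<close>.
\<close>

lemma walk_mean_norm:
  fixes S :: "'a::euclidean_space ^ 'd"
  assumes h: "h \<ge> 0" and r: "r \<ge> 0" and le: "(norm e)\<^sup>2 + h * (norm S)\<^sup>2 \<le> r\<^sup>2"
  shows "walk_mean h norm e S \<le> r"
proof -
  define m where "m = walk_mean h norm e S"
  have "walk_mean h (\<lambda>y. 2 * m * norm y) e S \<le> walk_mean h (\<lambda>y. m\<^sup>2 + (norm y)\<^sup>2) e S"
  proof (rule walk_mean_le[OF _ h])
    show "2 * m * norm z \<le> m\<^sup>2 + (norm z)\<^sup>2" for z :: 'a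
      by (rule sum_squares_bound)
  qed
  then have "m\<^sup>2 \<le> r\<^sup>2"
    using le walk_mean_norm_square[OF h, of e S]
    by (simp add: walk_mean_add walk_mean_const walk_mean_cmult m_def[symmetric] power2_eq_square)
  then show ?thesis using r power2_le_imp_le m_def by blast
qed

lemma walk_mean_abs_le:
  fixes S :: "'a::euclidean_space ^ 'd"
  assumes w: "\<And>y. \<bar>w y\<bar> \<le> c + L * norm y" and L: "L \<ge> 0" and h: "h \<ge> 0"
  shows "\<bar>walk_mean h w e S\<bar> \<le> c + L * (norm e + sqrt h * norm S)"
proof -
  let ?u = "\<lambda>y. c + L * norm y"
  have "(norm e)\<^sup>2 + h * (norm S)\<^sup>2 \<le> (norm e + sqrt h * norm S)\<^sup>2"
    using h by (simp add: power2_sum power_mult_distrib)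
  then have "walk_mean h norm e S \<le> norm e + sqrt h * norm S"
    using h by (intro walk_mean_norm) auto
  then have u: "walk_mean h ?u e S \<le> c + L * (norm e + sqrt h * norm S)"
    using L by (simp add: walk_mean_add walk_mean_const walk_mean_cmult mult_left_mono)
  have "walk_mean h w e S \<le> walk_mean h ?u e S"
    using w by (intro walk_mean_le[OF _ h]) (simp add: abs_le_iff)
  moreover have "walk_mean h (\<lambda>y. -1 * w y) e S \<le> walk_mean h ?u e S"
    using w by (intro walk_mean_le[OF _ h]) (simp add: abs_le_iff)
  then have "- walk_mean h w e S \<le> walk_mean h ?u e S"
    unfolding walk_mean_cmult by simp
  ultimately show ?thesis using u by linarith
qed

section \<open>Fixed points and limits of families of functions\<close>

text \<open>
  The supremum of all \<open>z\<close> with \<open>z \<le> T z\<close> is a fixed point. Such \<open>z\<close> exist because the infimum of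
  the whole class is its least element. The bounds \<open>l\<close> and \<open>u\<close> make the pointwise suprema and infima
  of reals meaningful.
\<close>

lemma knaster_tarski_pointwise:
  fixes T :: "('a \<Rightarrow> real) \<Rightarrow> 'a \<Rightarrow> real"
  assumes "X \<noteq> {}"
    and lower: "\<And>z x. z \<in> X \<Longrightarrow> l x \<le> z x" and upper: "\<And>z x. z \<in> X \<Longrightarrow> z x \<le> u x"
    and SUP: "\<And>Z. Z \<subseteq> X \<Longrightarrow> Z \<noteq> {} \<Longrightarrow> (\<lambda>x. SUP z\<in>Z. z x) \<in> X"
    and INF: "\<And>Z. Z \<subseteq> X \<Longrightarrow> Z \<noteq> {} \<Longrightarrow> (\<lambda>x. INF z\<in>Z. z x) \<in> X"
    and maps: "\<And>z. z \<in> X \<Longrightarrow> T z \<in> X"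
    and mono: "\<And>z z' x. z \<in> X \<Longrightarrow> z' \<in> X \<Longrightarrow> (\<And>y. z y \<le> z' y) \<Longrightarrow> T z x \<le> T z' x"
  obtains w where "w \<in> X" "T w = w"
proof -
  define S where "S = {z \<in> X. \<forall>x. z x \<le> T z x}"
  define z0 where "z0 = (\<lambda>x. INF z\<in>X. z x)"
  have z0: "z0 \<in> X" unfolding z0_def by (rule INF) (use assms(1) in auto)
  have "z0 x \<le> z x" if "z \<in> X" for z x
    unfolding z0_def using that lower by (intro cINF_lower bdd_belowI[where m="l x"]) auto
  then have "z0 \<in> S" using z0 maps by (auto simp: S_def)
  then have ne: "S \<noteq> {}" by auto
  define w where "w = (\<lambda>x. SUP z\<in>S. z x)"
  have wX: "w \<in> X" unfolding w_def by (rule SUP) (use ne in \<open>auto simp: S_def\<close>)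
  have w_ub: "z x \<le> w x" if "z \<in> S" for z x
    unfolding w_def using that upper by (intro cSUP_upper bdd_aboveI[where M="u x"]) (auto simp: S_def)
  have le: "w x \<le> T w x" for x
    unfolding w_def
  proof (rule cSUP_least[OF ne], fold w_def)
    fix z assume z: "z \<in> S"
    then have "z x \<le> T z x" by (auto simp: S_def)
    also have "\<dots> \<le> T w x" using z w_ub wX by (intro mono) (auto simp: S_def)
    finally show "z x \<le> T w x" .
  qed
  have "T w \<in> S" using wX le maps mono by (auto simp: S_def)
  then have "T w x \<le> w x" for x using w_ub by auto
  with le have "T w = w" by (auto intro: antisym)
  with wX that show thesis by blast
qed

text \<open>
  A diagonal sequence converges on a countable dense set, and equicontinuity carries this over to
  every point. The diagonal argument needs a uniform bound, hence the division by \<open>1 + |x|\<close>.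
\<close>

lemma lipschitz_subsequence_converges:
  fixes v :: "nat \<Rightarrow> 'a::euclidean_space \<Rightarrow> real"
  assumes lip: "\<And>n x y. \<bar>v n x - v n y\<bar> \<le> L * norm (x - y)" and zero: "\<And>n. v n 0 = 0"
  obtains k w where "strict_mono (k :: nat \<Rightarrow> nat)" "\<And>x. (\<lambda>n. v (k n) x) \<longlonglongrightarrow> w x"
proof -
  have L0: "L * norm x \<ge> 0" for x :: 'a
    using lip[of 0 x 0] by (simp add: order_trans[OF abs_ge_zero])
  have bd: "\<bar>v n x\<bar> \<le> L * norm x" for n x using lip[of n x 0] zero by simp
  obtain D :: "'a set" where D: "countable D" "\<And>A. open A \<Longrightarrow> A \<noteq> {} \<Longrightarrow> \<exists>d\<in>D. d \<in> A"
    using countable_dense_setE by blast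
  have "norm (v n x / (1 + norm x)) \<le> \<bar>L\<bar>" for n x
  proof -
    have "\<bar>v n x\<bar> \<le> \<bar>L\<bar> * (1 + norm x)"
      using bd[of n x] mult_right_mono[OF abs_ge_self, of "norm x" L] abs_ge_zero[of L]
      by (simp add: algebra_simps)
    then show ?thesis by (simp add: field_simps add_nonneg_eq_0_iff add_pos_nonneg abs_of_pos)
  qed
  then obtain k where k: "strict_mono (k :: nat \<Rightarrow> nat)"
      and conv: "\<And>x. x \<in> D \<Longrightarrow> \<exists>l. (\<lambda>n. v (k n) x / (1 + norm x)) \<longlonglongrightarrow> l"
    using function_convergent_subsequence[OF D(1), of "\<lambda>n x. v n x / (1 + norm x)" "\<bar>L\<bar>"] by metis
  have conv': "convergent (\<lambda>n. v (k n) x)" if "x \<in> D" for x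
  proof -
    obtain l where "(\<lambda>n. v (k n) x / (1 + norm x)) \<longlonglongrightarrow> l" using conv[OF \<open>x \<in> D\<close>] by blast
    then have "(\<lambda>n. v (k n) x / (1 + norm x) * (1 + norm x)) \<longlonglongrightarrow> l * (1 + norm x)"
      by (intro tendsto_intros)
    moreover have "1 + norm x \<noteq> 0" using norm_ge_zero[of x] by linarith
    ultimately show ?thesis by (auto simp: convergent_def)
  qed
  have "convergent (\<lambda>n. v (k n) x)" for x
  proof (rule Cauchy_convergent, rule metric_CauchyI)
    fix e :: real assume e: "0 < e"
    define r where "r = e / (4 * (\<bar>L\<bar> + 1))"
    have r: "r > 0" using e by (simp add: r_def)
    obtain d where d: "d \<in> D" "norm (x - d) < r"
      using D(2)[of "ball x r"] r by (auto simp: dist_norm)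
    have "\<bar>L\<bar> * norm (x - d) \<le> (\<bar>L\<bar> + 1) * r"
      using d by (intro mult_mono) auto
    also have "\<dots> = e / 4" by (simp add: r_def field_simps)
    finally have le: "\<bar>v n x - v n d\<bar> \<le> e / 4" for n
      using lip[of n x d] mult_right_mono[OF abs_ge_self, of "norm (x - d)" L] by simp
    obtain N where N: "\<And>m n. m \<ge> N \<Longrightarrow> n \<ge> N \<Longrightarrow> dist (v (k m) d) (v (k n) d) < e / 2"
      using metric_CauchyD[OF convergent_Cauchy[OF conv'[OF d(1)]], of "e/2"] e by auto
    then have "dist (v (k m) x) (v (k n) x) < e" if "m \<ge> N" "n \<ge> N" for m n
      using le[of "k m"] le[of "k n"] N[OF that]
      unfolding dist_real_def abs_less_iff abs_le_iff by (intro conjI) linarith+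
    then show "\<exists>M. \<forall>m\<ge>M. \<forall>n\<ge>M. dist (v (k m) x) (v (k n) x) < e" by blast
  qed
  then have "(\<lambda>n. v (k n) x) \<longlonglongrightarrow> lim (\<lambda>n. v (k n) x)" for x
    by (simp add: convergent_LIMSEQ_iff)
  then show thesis by (rule that[OF k])
qed

lemma lipschitz_limit_uniform_on_cball:
  fixes v :: "nat \<Rightarrow> 'a::euclidean_space \<Rightarrow> real"
  assumes lip: "\<And>n x y. \<bar>v n x - v n y\<bar> \<le> L * norm (x - y)"
    and lim: "\<And>x. (\<lambda>n. v n x) \<longlonglongrightarrow> w x"
  shows "\<And>x y. \<bar>w x - w y\<bar> \<le> L * norm (x - y)"
    and "uniform_limit (cball c r) v w sequentially"
proof -
  show wlip: "\<bar>w x - w y\<bar> \<le> L * norm (x - y)" for x y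
    by (rule tendsto_upperbound[of "\<lambda>n. \<bar>v n x - v n y\<bar>" _ sequentially])
       (auto intro!: tendsto_intros lim always_eventually lip)
  show "uniform_limit (cball c r) v w sequentially"
  proof (rule uniform_limitI)
    fix e :: real assume e: "0 < e"
    define s where "s = e / (4 * (\<bar>L\<bar> + 1))"
    have s: "s > 0" using e by (simp add: s_def)
    have small: "L * norm (x - y) \<le> e / 4" if "norm (x - y) < s" for x y :: 'a
    proof -
      have "L * norm (x - y) \<le> (\<bar>L\<bar> + 1) * s"
        using that by (intro mult_mono) auto
      also have "\<dots> = e / 4" by (simp add: s_def field_simps)
      finally show ?thesis .
    qed
    obtain F where F: "finite F" "cball c r \<subseteq> (\<Union>x\<in>F. ball x s)"
      using compact_cball[of c r] s unfolding compact_eq_totally_bounded by blast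
    have "\<forall>\<^sub>F n in sequentially. \<forall>x\<in>F. dist (v n x) (w x) < e / 2"
      using e F(1) by (intro eventually_ball_finite ballI tendstoD[OF lim]) auto
    then show "\<forall>\<^sub>F n in sequentially. \<forall>x\<in>cball c r. dist (v n x) (w x) < e"
    proof eventually_elim
      case (elim n)
      show ?case
      proof
        fix x assume "x \<in> cball c r"
        then obtain y where y: "y \<in> F" "norm (x - y) < s"
          using F(2) by (force simp: dist_norm norm_minus_commute)
        have "\<bar>v n y - w y\<bar> < e / 2" using elim y(1) by (simp add: dist_real_def)
        then show "dist (v n x) (w x) < e"
          using small[OF y(2)] lip[of n x y] wlip[of x y]
          unfolding dist_real_def abs_less_iff abs_le_iff by (intro conjI) linarith+
      qed
    qed
  qed
qed

section \<open>Dissipative games and the time-discrete operator\<close>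

lemma power2_norm_add: "(norm (x + y :: 'a::real_inner))\<^sup>2 = (norm x)\<^sup>2 + 2 * (x \<bullet> y) + (norm y)\<^sup>2"
  by (simp add: power2_norm_eq_inner algebra_simps inner_commute)

lemma bounded_bilinear_combination:
  fixes Q Q' :: "'a::real_normed_vector \<Rightarrow> 'b::real_normed_vector \<Rightarrow> real"
  assumes Q: "bounded_bilinear Q" and Q': "bounded_bilinear Q'"
  shows "bounded_bilinear (\<lambda>y z. c * Q y z + c' * Q' y z)"
proof -
  interpret Q: bounded_bilinear Q by (rule Q)
  interpret Q': bounded_bilinear Q' by (rule Q')
  obtain N N' where N: "\<And>y z. \<bar>Q y z\<bar> \<le> norm y * norm z * N" "\<And>y z. \<bar>Q' y z\<bar> \<le> norm y * norm z * N'"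
    using Q.nonneg_bounded Q'.nonneg_bounded by (metis real_norm_def)
  have "\<bar>c * Q y z + c' * Q' y z\<bar> \<le> norm y * norm z * (\<bar>c\<bar> * N + \<bar>c'\<bar> * N')" for y z
  proof -
    have "\<bar>c * Q y z + c' * Q' y z\<bar> \<le> \<bar>c\<bar> * \<bar>Q y z\<bar> + \<bar>c'\<bar> * \<bar>Q' y z\<bar>"
      unfolding abs_mult[symmetric] by (rule abs_triangle_ineq)
    also have "\<dots> \<le> \<bar>c\<bar> * (norm y * norm z * N) + \<bar>c'\<bar> * (norm y * norm z * N')"
      by (intro add_mono mult_left_mono N abs_ge_zero)
    finally show ?thesis by (simp only: distrib_left mult.left_commute)
  qed
  then have "\<exists>K. \<forall>y z. norm (c * Q y z + c' * Q' y z) \<le> norm y * norm z * K" by auto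
  then show ?thesis
    by unfold_locales
       (simp_all add: Q.add_left Q.add_right Q.scaleR_left Q.scaleR_right
          Q'.add_left Q'.add_right Q'.scaleR_left Q'.scaleR_right algebra_simps)
qed

text \<open>
  The functional \<open>G\<close> stands for the inf-sup over the controls in \<open>I\<close>. It is kept abstract because
  the conditions on it are self-dual, unlike the inf-sup itself. The first condition combines monotonicity
  with compatibility with additive constants. Bounded families only are considered, since the
  suprema of reals are unspecified otherwise. The columns of the diffusion matrix form one vector
  \<open>s x a :: 'a ^ 'd\<close>, whose norm is the Hilbert-Schmidt norm of the matrix.
\<close>

definition dissipative_game ::
  "'c set \<Rightarrow> (('c \<Rightarrow> real) \<Rightarrow> real) \<Rightarrow> ('a::euclidean_space \<Rightarrow> 'c \<Rightarrow> 'a) \<Rightarrow>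
   ('a \<Rightarrow> 'c \<Rightarrow> 'a ^ 'd) \<Rightarrow> ('a \<Rightarrow> 'c \<Rightarrow> real) \<Rightarrow> real \<Rightarrow> real \<Rightarrow> real \<Rightarrow> real \<Rightarrow> real \<Rightarrow> bool" where
  "dissipative_game I G b s f Cb Cf Cs K B \<longleftrightarrow>
     (\<forall>F F' c. bounded (F ` I) \<longrightarrow> bounded (F' ` I) \<longrightarrow> (\<forall>a\<in>I. F a \<le> F' a + c) \<longrightarrow> G F \<le> G F' + c) \<and>
     (\<forall>F t. bounded (F ` I) \<longrightarrow> 0 < t \<longrightarrow> G (\<lambda>a. t * F a) = t * G F) \<and>
     0 \<le> Cb \<and> 0 \<le> Cf \<and> 0 \<le> Cs \<and> 0 \<le> B \<and> Cs\<^sup>2 < K \<and>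
     (\<forall>a\<in>I. (\<forall>x y. norm (b x a - b y a) \<le> Cb * norm (x - y) \<and>
                  \<bar>f x a - f y a\<bar> \<le> Cf * norm (x - y) \<and>
                  norm (s x a - s y a) \<le> Cs * norm (x - y) \<and>
                  2 * ((x - y) \<bullet> (b x a - b y a)) \<le> - K * (norm (x - y))\<^sup>2) \<and>
            norm (b 0 a) \<le> B \<and> norm (s 0 a) \<le> B \<and> \<bar>f 0 a\<bar> \<le> B)"

lemma dissipative_game_dual:
  assumes "dissipative_game I G b s f Cb Cf Cs K B"
  shows "dissipative_game I (\<lambda>F. - G (\<lambda>a. - F a)) b s (\<lambda>x a. - f x a) Cb Cf Cs K B"
proof -
  have bd: "bounded ((\<lambda>a. - F a) ` I)" if "bounded (F ` I)" for F :: "'a \<Rightarrow> real"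
    using that by (metis bounded_uminus image_image)
  have le: "G F \<le> G F' + c" if "bounded (F ` I)" "bounded (F' ` I)" "\<forall>a\<in>I. F a \<le> F' a + c" for F F' c
    using assms that unfolding dissipative_game_def by blast
  have scale: "G (\<lambda>a. t * F a) = t * G F" if "bounded (F ` I)" "0 < t" for F t
    using assms that unfolding dissipative_game_def by blast
  have "- G (\<lambda>a. - F a) \<le> - G (\<lambda>a. - F' a) + c"
    if "bounded (F ` I)" "bounded (F' ` I)" "\<forall>a\<in>I. F a \<le> F' a + c" for F F' c
    using le[of "\<lambda>a. - F' a" "\<lambda>a. - F a" c] that bd by fastforce
  moreover have "- G (\<lambda>a. - (t * F a)) = t * - G (\<lambda>a. - F a)" if "bounded (F ` I)" "0 < t" for F t
    using scale[OF bd] that by simp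
  moreover have "\<bar>- f x a - - f y a\<bar> = \<bar>f x a - f y a\<bar>" for x y a
    by (simp add: abs_minus_commute)
  ultimately show ?thesis
    using assms unfolding dissipative_game_def by simp
qed

context
  fixes I :: "'c set" and G :: "('c \<Rightarrow> real) \<Rightarrow> real"
    and b :: "'a::euclidean_space \<Rightarrow> 'c \<Rightarrow> 'a" and s :: "'a \<Rightarrow> 'c \<Rightarrow> 'a ^ 'd"
    and f :: "'a \<Rightarrow> 'c \<Rightarrow> real" and Cb Cf Cs K B :: real
  assumes game: "dissipative_game I G b s f Cb Cf Cs K B"
begin

lemma value_le: "bounded (F ` I) \<Longrightarrow> bounded (F' ` I) \<Longrightarrow>
      (\<And>a. a \<in> I \<Longrightarrow> F a \<le> F' a + c) \<Longrightarrow> G F \<le> G F' + c"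
  and value_scale: "bounded (F ` I) \<Longrightarrow> 0 < t \<Longrightarrow> G (\<lambda>a. t * F a) = t * G F"
  and nonneg: "0 \<le> Cb" "0 \<le> Cf" "0 \<le> Cs" "0 \<le> B"
  and b_lip: "a \<in> I \<Longrightarrow> norm (b x a - b y a) \<le> Cb * norm (x - y)"
  and f_lip: "a \<in> I \<Longrightarrow> \<bar>f x a - f y a\<bar> \<le> Cf * norm (x - y)"
  and s_lip: "a \<in> I \<Longrightarrow> norm (s x a - s y a) \<le> Cs * norm (x - y)"
  and gap: "Cs\<^sup>2 < K"
  and diss: "a \<in> I \<Longrightarrow> 2 * ((x - y) \<bullet> (b x a - b y a)) \<le> - K * (norm (x - y))\<^sup>2"
  and at_origin: "a \<in> I \<Longrightarrow> norm (b 0 a) \<le> B" "a \<in> I \<Longrightarrow> norm (s 0 a) \<le> B" "a \<in> I \<Longrightarrow> \<bar>f 0 a\<bar> \<le> B"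
  using game unfolding dissipative_game_def by blast+

text \<open>
  A quarter of the gap \<open>K - Cs\<^sup>2\<close>: the remaining part absorbs the error terms of order \<open>h\<^sup>2\<close> caused
  by the square of the drift.
\<close>

definition \<kappa> :: real where "\<kappa> = (K - Cs\<^sup>2) / 4"

text \<open>
  The value at which the growth \<open>h Cf\<close> of the Lipschitz constant caused by the reward balances
  its decay by the factor \<open>1 - h \<kappa>\<close>.
\<close>

definition L :: real where "L = Cf / \<kappa>"

lemma kappa_pos: "0 < \<kappa>" using gap by (simp add: \<kappa>_def)

lemma kappa_eq: "4 * \<kappa> = K - Cs\<^sup>2" by (simp add: \<kappa>_def)

lemma L_nonneg: "0 \<le> L" using kappa_pos nonneg by (simp add: L_def)

definition small :: "real \<Rightarrow> bool" where
  "small h \<longleftrightarrow> 0 < h \<and> h \<le> 1 / 2 \<and> h * \<kappa> \<le> 1 \<and> h * Cb\<^sup>2 \<le> \<kappa>"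

definition lip :: "('a \<Rightarrow> real) \<Rightarrow> bool" where
  "lip w \<longleftrightarrow> (\<forall>x y. \<bar>w x - w y\<bar> \<le> L * norm (x - y))"

definition walk :: "real \<Rightarrow> ('a \<Rightarrow> real) \<Rightarrow> 'a \<Rightarrow> 'c \<Rightarrow> real" where
  "walk h w x a = walk_mean h w (x + h *\<^sub>R b x a) (s x a)"

text \<open>
  Any discount factor \<open>1 - \<delta> h\<close> with \<open>\<delta> \<rightarrow> 0\<close> would serve. The choice \<open>\<delta> = h\<close> lets the discount
  and the step vanish in one limit.
\<close>

definition step :: "real \<Rightarrow> ('a \<Rightarrow> real) \<Rightarrow> 'a \<Rightarrow> real" where
  "step h w x = G (\<lambda>a. walk h (\<lambda>y. (1 - h\<^sup>2) * w y) x a + h * f x a)"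

lemma b_bound: "a \<in> I \<Longrightarrow> norm (b x a) \<le> Cb * norm x + B"
  using b_lip[of a x 0] at_origin(1)[of a] norm_triangle_sub[of "b x a" "b 0 a"] by simp

lemma s_bound: "a \<in> I \<Longrightarrow> norm (s x a) \<le> Cs * norm x + B"
  using s_lip[of a x 0] at_origin(2)[of a] norm_triangle_sub[of "s x a" "s 0 a"] by simp

lemma f_bound: "a \<in> I \<Longrightarrow> \<bar>f x a\<bar> \<le> Cf * norm x + B"
  using f_lip[of a x 0] at_origin(3)[of a] by simp

section \<open>Contraction of distances and Lipschitz bounds\<close>

text \<open>
  Synchronous coupling. The mean square of the new distance is at most
  \<open>(1 - h K + h\<^sup>2 Cb\<^sup>2 + h Cs\<^sup>2) |x - y|\<^sup>2\<close>, and for small \<open>h\<close> the bracket is at most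
  \<open>(1 - h \<kappa>)\<^sup>2\<close>.
\<close>

lemma walk_coupling:
  assumes a: "a \<in> I" and h: "small h"
  shows "walk_mean h norm ((x + h *\<^sub>R b x a) - (y + h *\<^sub>R b y a)) (s x a - s y a)
           \<le> (1 - h * \<kappa>) * norm (x - y)"
proof (rule walk_mean_norm)
  let ?N = "(norm (x - y))\<^sup>2" and ?d = "b x a - b y a"
  have h0: "0 < h" "h * \<kappa> \<le> 1" "h * Cb\<^sup>2 \<le> \<kappa>" using h by (auto simp: small_def)
  have "h * (2 * ((x - y) \<bullet> ?d)) \<le> h * (- K * ?N)"
    using h0 diss[OF a] by (intro mult_left_mono) auto
  moreover have "(norm ?d)\<^sup>2 \<le> Cb\<^sup>2 * ?N"
    using power_mono[OF b_lip[OF a, of x y] norm_ge_zero, of 2] by (simp add: power_mult_distrib)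
  then have "h * (norm ?d)\<^sup>2 \<le> h * (Cb\<^sup>2 * ?N)"
    using h0 by (intro mult_left_mono) auto
  then have "h * (norm ?d)\<^sup>2 \<le> \<kappa> * ?N"
    using mult_right_mono[OF h0(3), of ?N] by (simp add: mult.assoc)
  then have "h * (h * (norm ?d)\<^sup>2) \<le> h * (\<kappa> * ?N)"
    using h0 by (intro mult_left_mono) auto
  moreover have "(norm (s x a - s y a))\<^sup>2 \<le> Cs\<^sup>2 * ?N"
    using power_mono[OF s_lip[OF a, of x y] norm_ge_zero, of 2] by (simp add: power_mult_distrib)
  then have "h * (norm (s x a - s y a))\<^sup>2 \<le> h * (Cs\<^sup>2 * ?N)"
    using h0 by (intro mult_left_mono) auto
  moreover have "(norm ((x + h *\<^sub>R b x a) - (y + h *\<^sub>R b y a)))\<^sup>2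
      = ?N + h * (2 * ((x - y) \<bullet> ?d)) + h * (h * (norm ?d)\<^sup>2)"
  proof -
    have "(x + h *\<^sub>R b x a) - (y + h *\<^sub>R b y a) = (x - y) + h *\<^sub>R ?d" by (simp add: algebra_simps)
    then show ?thesis by (simp only: power2_norm_add) (simp add: power_mult_distrib power2_eq_square)
  qed
  moreover have "h * (- K * ?N) = - 4 * (h * (\<kappa> * ?N)) - h * (Cs\<^sup>2 * ?N)"
    using kappa_eq by algebra
  moreover have "0 \<le> h * (\<kappa> * ?N)" "0 \<le> (h * \<kappa>)\<^sup>2 * ?N" using h0 kappa_pos by auto
  moreover have "((1 - h * \<kappa>) * norm (x - y))\<^sup>2 = ?N - 2 * (h * (\<kappa> * ?N)) + (h * \<kappa>)\<^sup>2 * ?N"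
    by (simp add: power_mult_distrib power2_diff algebra_simps) (simp add: power2_eq_square)
  ultimately show "(norm ((x + h *\<^sub>R b x a) - (y + h *\<^sub>R b y a)))\<^sup>2 + h * (norm (s x a - s y a))\<^sup>2
      \<le> ((1 - h * \<kappa>) * norm (x - y))\<^sup>2"
    by linarith
qed (use h in \<open>auto simp: small_def\<close>)

lemma lip_cmult: "lip w \<Longrightarrow> 0 \<le> t \<Longrightarrow> t \<le> 1 \<Longrightarrow> lip (\<lambda>y. t * w y)"
proof -
  assume w: "lip w" and t: "0 \<le> t" "t \<le> 1"
  have "\<bar>t * w x - t * w y\<bar> \<le> L * norm (x - y)" for x y
  proof -
    have "\<bar>t * w x - t * w y\<bar> = t * \<bar>w x - w y\<bar>"
      using t by (simp add: abs_mult flip: right_diff_distrib)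
    also have "\<dots> \<le> \<bar>w x - w y\<bar>" using t by (intro mult_left_le_one_le) auto
    also have "\<dots> \<le> L * norm (x - y)" using w by (simp add: lip_def)
    finally show ?thesis .
  qed
  then show ?thesis by (simp add: lip_def)
qed

lemma lip_discount: "lip w \<Longrightarrow> small h \<Longrightarrow> lip (\<lambda>y. (1 - h\<^sup>2) * w y)"
  by (rule lip_cmult) (auto simp: small_def power_le_one)

text \<open>
  By the coupling the mean of \<open>w\<close> loses \<open>L h \<kappa> |x - y|\<close>, which is exactly the variation
  \<open>h Cf |x - y|\<close> allowed to the reward.
\<close>

lemma walk_lipschitz:
  assumes a: "a \<in> I" and h: "small h" and w: "lip w"
  shows "walk h w x a + h * f x a \<le> walk h w y a + h * f y a + L * norm (x - y)"
proof -
  have h0: "h > 0" using h by (simp add: small_def)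
  let ?e = "\<lambda>x. x + h *\<^sub>R b x a"
  have "walk h w x a \<le> walk h w y a + walk_mean h (\<lambda>z. L * norm z) (?e x - ?e y) (s x a - s y a)"
    unfolding walk_def
  proof (rule walk_mean_le_add)
    fix j and c :: real
    have "w (?e x + c *\<^sub>R s x a $ j) - w (?e y + c *\<^sub>R s y a $ j)
      \<le> L * norm ((?e x + c *\<^sub>R s x a $ j) - (?e y + c *\<^sub>R s y a $ j))"
      using w abs_le_D1 unfolding lip_def by blast
    moreover have "(?e x + c *\<^sub>R s x a $ j) - (?e y + c *\<^sub>R s y a $ j)
      = (?e x - ?e y) + c *\<^sub>R (s x a - s y a) $ j"
      by (simp add: algebra_simps)
    ultimately show "w (?e x + c *\<^sub>R s x a $ j)
       \<le> w (?e y + c *\<^sub>R s y a $ j) + L * norm ((?e x - ?e y) + c *\<^sub>R (s x a - s y a) $ j)"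
      by simp
  qed (use h0 in simp)
  also have "walk_mean h (\<lambda>z. L * norm z) (?e x - ?e y) (s x a - s y a)
      \<le> L * ((1 - h * \<kappa>) * norm (x - y))"
    unfolding walk_mean_cmult using walk_coupling[OF a h] L_nonneg by (intro mult_left_mono)
  also have "\<dots> = L * norm (x - y) - h * (Cf * norm (x - y))"
    using kappa_pos by (simp add: L_def field_simps)
  finally have "walk h w x a \<le> walk h w y a + (L * norm (x - y) - h * (Cf * norm (x - y)))"
    by simp
  moreover have "h * (f x a - f y a) \<le> h * (Cf * norm (x - y))"
    using f_lip[OF a, of x y] h0 by (intro mult_left_mono) auto
  ultimately show ?thesis by (simp add: algebra_simps)
qed

lemma walk_bounded:
  assumes w: "lip w" and h: "0 < h"
  shows "bounded ((\<lambda>a. walk h w x a + h * f x a) ` I)"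
proof (rule boundedI[of _ "\<bar>w 0\<bar> + L * ((norm x + h * (Cb * norm x + B)) + sqrt h * (Cs * norm x + B))
           + h * (Cf * norm x + B)"])
  fix z assume "z \<in> (\<lambda>a. walk h w x a + h * f x a) ` I"
  then obtain a where a: "a \<in> I" and z: "z = walk h w x a + h * f x a" by auto
  have "\<bar>w y\<bar> \<le> \<bar>w 0\<bar> + L * norm y" for y
    using w[unfolded lip_def, rule_format, of y 0] by simp
  then have "\<bar>walk h w x a\<bar> \<le> \<bar>w 0\<bar> + L * (norm (x + h *\<^sub>R b x a) + sqrt h * norm (s x a))"
    unfolding walk_def using L_nonneg h by (intro walk_mean_abs_le) auto
  also have "\<dots> \<le> \<bar>w 0\<bar> + L * ((norm x + h * (Cb * norm x + B)) + sqrt h * (Cs * norm x + B))"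
  proof (intro add_left_mono mult_left_mono add_mono L_nonneg s_bound[OF a])
    show "norm (x + h *\<^sub>R b x a) \<le> norm x + h * (Cb * norm x + B)"
    proof -
      have "norm (h *\<^sub>R b x a) \<le> h * (Cb * norm x + B)" using b_bound[OF a, of x] h by simp
      then show ?thesis using norm_triangle_ineq[of x "h *\<^sub>R b x a"] by linarith
    qed
  qed (use h in simp)
  finally have wb: "\<bar>walk h w x a\<bar> \<le> \<bar>w 0\<bar> + L * ((norm x + h * (Cb * norm x + B)) + sqrt h * (Cs * norm x + B))" .
  show "norm z \<le> \<bar>w 0\<bar> + L * ((norm x + h * (Cb * norm x + B)) + sqrt h * (Cs * norm x + B))
           + h * (Cf * norm x + B)"
  proof -
    have "\<bar>h * f x a\<bar> \<le> h * (Cf * norm x + B)"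
      using f_bound[OF a, of x] h by (simp add: abs_mult)
    from order_trans[OF abs_triangle_ineq add_mono[OF wb this]]
    show ?thesis unfolding z real_norm_def .
  qed
qed

lemma step_lip:
  assumes h: "small h" and w: "lip w"
  shows "lip (step h w)"
proof -
  have "step h w x \<le> step h w y + L * norm (x - y)" for x y
    unfolding step_def
    using h walk_lipschitz[OF _ h lip_discount[OF w h]] walk_bounded[OF lip_discount[OF w h]]
    by (intro value_le) (auto simp: small_def)
  then show ?thesis
    unfolding lip_def by (metis abs_le_iff diff_le_eq add.commute minus_diff_eq norm_minus_commute)
qed

section \<open>Quadratic barrier\<close>

text \<open>
  The maximum over \<open>r \<ge> 0\<close> of \<open>m r - 2 \<kappa> r\<^sup>2\<close> is \<open>m\<^sup>2 / (8 \<kappa>)\<close>. Here \<open>m\<close> is the coefficient of the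
  terms of linear growth in the drift of \<open>|x|\<^sup>2\<close> and in the reward.
\<close>

definition drift_bound :: real where
  "drift_bound = 3 * B\<^sup>2 + B + (2 * B + 2 * Cs * B + Cf)\<^sup>2 / (8 * \<kappa>)"

lemma drift_bound_nonneg: "0 \<le> drift_bound"
  using kappa_pos nonneg by (simp add: drift_bound_def)

text \<open>
  The terms of second order in \<open>|x|\<close> that one step adds sum to at most \<open>- 2 h \<kappa> |x|\<^sup>2\<close>, which dominates those of
  first order, including the reward.
\<close>

lemma quadratic_drift:
  assumes a: "a \<in> I" and h: "small h"
  shows "(norm (x + h *\<^sub>R b x a))\<^sup>2 + h * (norm (s x a))\<^sup>2 + h * \<bar>f x a\<bar> \<le> (norm x)\<^sup>2 + h * drift_bound"
proof -
  define r where "r = norm x"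
  define m where "m = 2 * B + 2 * Cs * B + Cf"
  have h0: "0 < h" "h \<le> 1/2" "h * Cb\<^sup>2 \<le> \<kappa>" using h by (auto simp: small_def)
  have r: "0 \<le> r" by (simp add: r_def)
  have "2 * (x \<bullet> b x a) = 2 * (x \<bullet> (b x a - b 0 a)) + 2 * (x \<bullet> b 0 a)"
    by (simp add: algebra_simps)
  also have "\<dots> \<le> - K * r\<^sup>2 + 2 * (r * B)"
  proof (rule add_mono)
    show "2 * (x \<bullet> (b x a - b 0 a)) \<le> - K * r\<^sup>2" using diss[OF a, of x 0] by (simp add: r_def)
    have "x \<bullet> b 0 a \<le> r * norm (b 0 a)" unfolding r_def by (rule norm_cauchy_schwarz)
    also have "\<dots> \<le> r * B" using at_origin(1)[OF a] r by (intro mult_left_mono)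
    finally show "2 * (x \<bullet> b 0 a) \<le> 2 * (r * B)" by simp
  qed
  finally have 1: "2 * (x \<bullet> b x a) \<le> - K * r\<^sup>2 + 2 * (r * B)" .
  have "(norm (b x a))\<^sup>2 \<le> (Cb * r + B)\<^sup>2"
    using b_bound[OF a, of x] by (intro power_mono) (auto simp: r_def)
  also have "\<dots> \<le> 2 * Cb\<^sup>2 * r\<^sup>2 + 2 * B\<^sup>2"
    using sum_squares_bound[of "Cb * r" B] by (simp add: power2_sum power_mult_distrib)
  finally have "h * (norm (b x a))\<^sup>2 \<le> h * (2 * Cb\<^sup>2 * r\<^sup>2 + 2 * B\<^sup>2)"
    using h0 by (intro mult_left_mono) auto
  also have "\<dots> = 2 * (h * Cb\<^sup>2 * r\<^sup>2) + 2 * h * B\<^sup>2" by (simp add: algebra_simps)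
  also have "\<dots> \<le> 2 * (\<kappa> * r\<^sup>2) + 1 * B\<^sup>2"
    using h0 by (intro add_mono mult_left_mono mult_right_mono) auto
  finally have 2: "h * (norm (b x a))\<^sup>2 \<le> 2 * \<kappa> * r\<^sup>2 + B\<^sup>2" by simp
  have "(norm (s x a))\<^sup>2 \<le> (Cs * r + B)\<^sup>2"
    using s_bound[OF a, of x] by (intro power_mono) (auto simp: r_def)
  then have 3: "(norm (s x a))\<^sup>2 \<le> Cs\<^sup>2 * r\<^sup>2 + 2 * Cs * B * r + B\<^sup>2"
    by (simp add: power2_sum power_mult_distrib algebra_simps)
  have 4: "\<bar>f x a\<bar> \<le> Cf * r + B" using f_bound[OF a] by (simp add: r_def)
  have "0 \<le> 2 * \<kappa> * (r - m / (4 * \<kappa>))\<^sup>2" using kappa_pos by simp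
  also have "\<dots> = 2 * \<kappa> * r\<^sup>2 - m * r + m\<^sup>2 / (8 * \<kappa>)"
    using kappa_pos by (simp add: power2_diff field_simps power2_eq_square)
  finally have 5: "m * r \<le> 2 * \<kappa> * r\<^sup>2 + m\<^sup>2 / (8 * \<kappa>)" by simp
  have 6: "K * r\<^sup>2 = 4 * \<kappa> * r\<^sup>2 + Cs\<^sup>2 * r\<^sup>2"
    using kappa_eq by algebra
  have "2 * (x \<bullet> b x a) + h * (norm (b x a))\<^sup>2 + (norm (s x a))\<^sup>2 + \<bar>f x a\<bar>
      \<le> (- 2 * \<kappa> * r\<^sup>2 + m * r) + 2 * B\<^sup>2 + B"
    using 1 2 3 4 6 unfolding m_def by (simp add: algebra_simps)
  also have "\<dots> \<le> drift_bound" using 5 zero_le_power2[of B] unfolding drift_bound_def m_def by linarith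
  finally have "h * (2 * (x \<bullet> b x a) + h * (norm (b x a))\<^sup>2 + (norm (s x a))\<^sup>2 + \<bar>f x a\<bar>) \<le> h * drift_bound"
    using h0 by (intro mult_left_mono) auto
  moreover have "(norm (x + h *\<^sub>R b x a))\<^sup>2 = (norm x)\<^sup>2 + h * (2 * (x \<bullet> b x a)) + h * (h * (norm (b x a))\<^sup>2)"
    by (simp only: power2_norm_add) (simp add: power_mult_distrib power2_eq_square)
  ultimately show ?thesis by (simp add: distrib_left)
qed

lemma value_zero: "G (\<lambda>_. 0) = 0"
  using value_scale[of "\<lambda>_. 0" 2] by (simp add: image_constant_conv)

lemma value_abs_le:
  assumes "bounded (F ` I)" "\<And>a. a \<in> I \<Longrightarrow> \<bar>F a\<bar> \<le> c"
  shows "\<bar>G F\<bar> \<le> c"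
proof -
  have bd: "bounded ((\<lambda>_. 0 :: real) ` I)" by (simp add: image_constant_conv)
  have "G F \<le> G (\<lambda>_. 0) + c" "G (\<lambda>_. 0) \<le> G F + c"
    using assms by (intro value_le[OF _ bd] value_le[OF bd]; force simp: abs_le_iff)+
  then show ?thesis by (simp add: value_zero)
qed

definition barrier_class :: "real \<Rightarrow> ('a \<Rightarrow> real) set" where
  "barrier_class h = {w. lip w \<and> (\<forall>x. \<bar>w x\<bar> \<le> (norm x)\<^sup>2 + drift_bound / h)}"

text \<open>
  Discounting reduces the constant \<open>drift_bound / h\<close> by \<open>h drift_bound\<close>, which pays for the
  increase of the barrier in one step. The bound on \<open>h w 0\<close> that results is independent of \<open>h\<close>.
\<close>

lemma step_barrier_class:
  assumes h: "small h" and w: "w \<in> barrier_class h"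
  shows "step h w \<in> barrier_class h"
proof -
  have lip: "lip w" and bar: "\<And>x. \<bar>w x\<bar> \<le> (norm x)\<^sup>2 + drift_bound / h"
    using w by (auto simp: barrier_class_def)
  have h0: "0 < h" "h \<le> 1/2" using h by (auto simp: small_def)
  have d: "0 \<le> 1 - h\<^sup>2" using h0 by (simp add: power_le_one)
  have "\<bar>step h w x\<bar> \<le> (norm x)\<^sup>2 + drift_bound / h" for x
    unfolding step_def
  proof (rule value_abs_le)
    show "bounded ((\<lambda>a. walk h (\<lambda>y. (1 - h\<^sup>2) * w y) x a + h * f x a) ` I)"
      by (rule walk_bounded[OF lip_discount[OF lip h] h0(1)])
    fix a assume a: "a \<in> I"
    let ?e = "x + h *\<^sub>R b x a" and ?S = "s x a"
    let ?m = "(norm ?e)\<^sup>2 + h * (norm ?S)\<^sup>2"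
    have up: "walk_mean h (\<lambda>y. t * w y) ?e ?S \<le> ?m + drift_bound / h" if "\<bar>t\<bar> = 1" for t
    proof -
      have "walk_mean h (\<lambda>y. t * w y) ?e ?S \<le> walk_mean h (\<lambda>y. (norm y)\<^sup>2 + drift_bound / h) ?e ?S"
      proof (rule walk_mean_le)
        show "t * w z \<le> (norm z)\<^sup>2 + drift_bound / h" for z
          using bar[of z] abs_ge_self[of "t * w z"] that by (simp add: abs_mult)
      qed (use h0 in simp)
      also have "\<dots> = ?m + drift_bound / h"
        using h0 by (simp add: walk_mean_add walk_mean_const walk_mean_norm_square)
      finally show ?thesis .
    qed
    have "\<bar>walk_mean h w ?e ?S\<bar> \<le> ?m + drift_bound / h"
      using up[of 1] up[of "-1"] unfolding walk_mean_cmult by (simp add: abs_le_iff)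
    then have "\<bar>walk h (\<lambda>y. (1 - h\<^sup>2) * w y) x a\<bar> \<le> (1 - h\<^sup>2) * (?m + drift_bound / h)"
      using d by (simp add: walk_def walk_mean_cmult abs_mult mult_left_mono)
    also have "\<dots> \<le> ?m + (1 - h\<^sup>2) * (drift_bound / h)"
    proof -
      have "(1 - h\<^sup>2) * ?m \<le> ?m" using h0 by (intro mult_left_le_one_le) (auto simp: power_le_one)
      then show ?thesis by (simp only: distrib_left add_right_mono)
    qed
    also have "(1 - h\<^sup>2) * (drift_bound / h) = drift_bound / h - h * drift_bound"
      using h0 by (simp add: field_simps power2_eq_square)
    finally have walk_le: "\<bar>walk h (\<lambda>y. (1 - h\<^sup>2) * w y) x a\<bar> \<le> ?m + (drift_bound / h - h * drift_bound)" .
    have "\<bar>h * f x a\<bar> \<le> h * \<bar>f x a\<bar>" using h0 by (simp add: abs_mult)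
    from order_trans[OF abs_triangle_ineq add_mono[OF walk_le this]] quadratic_drift[OF a h, of x]
    show "\<bar>walk h (\<lambda>y. (1 - h\<^sup>2) * w y) x a + h * f x a\<bar> \<le> (norm x)\<^sup>2 + drift_bound / h"
      by linarith
  qed
  then show ?thesis using step_lip[OF h lip] by (simp add: barrier_class_def)
qed

section \<open>The time-discrete ergodic equation\<close>

lemma step_mono:
  assumes h: "small h" and "lip w" "lip w'" and le: "\<And>y. w y \<le> w' y"
  shows "step h w x \<le> step h w' x"
proof -
  have h0: "0 < h" "h\<^sup>2 \<le> 1" using h by (auto simp: small_def power_le_one)
  have "G (\<lambda>a. walk h (\<lambda>y. (1 - h\<^sup>2) * w y) x a + h * f x a)
      \<le> G (\<lambda>a. walk h (\<lambda>y. (1 - h\<^sup>2) * w' y) x a + h * f x a) + 0"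
  proof (rule value_le)
    show "walk h (\<lambda>y. (1 - h\<^sup>2) * w y) x a + h * f x a
        \<le> walk h (\<lambda>y. (1 - h\<^sup>2) * w' y) x a + h * f x a + 0" for a
      unfolding walk_def using h0 le by (simp add: walk_mean_le mult_left_mono)
  qed (use assms h0 lip_discount walk_bounded in blast)+
  then show ?thesis by (simp add: step_def)
qed

lemma barrier_class_SUP:
  assumes Z: "Z \<subseteq> barrier_class h" "Z \<noteq> {}"
  shows "(\<lambda>x. SUP z\<in>Z. z x) \<in> barrier_class h"
proof -
  define w where "w = (\<lambda>x. SUP z\<in>Z. z x)"
  have Zlip: "z x \<le> z y + L * norm (x - y)" and Zb: "\<bar>z x\<bar> \<le> (norm x)\<^sup>2 + drift_bound / h" if "z \<in> Z" for z x y
    using that Z(1) by (force simp: barrier_class_def lip_def abs_le_iff algebra_simps)+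
  have bdd: "bdd_above ((\<lambda>z. z x) ` Z)" for x
    using Zb[of _ x] by (intro bdd_aboveI[where M="(norm x)\<^sup>2 + drift_bound / h"]) (auto simp: abs_le_iff)
  have upper: "z x \<le> w x" if "z \<in> Z" for z x
    unfolding w_def using that bdd by (rule cSUP_upper)
  have least: "w x \<le> c" if "\<And>z. z \<in> Z \<Longrightarrow> z x \<le> c" for x c
    unfolding w_def using Z(2) that by (rule cSUP_least)
  have "w x \<le> w y + L * norm (x - y)" for x y
    using Zlip upper by (intro least) (meson add_right_mono order_trans)
  then have "lip w"
    unfolding lip_def by (metis abs_le_iff diff_le_eq add.commute minus_diff_eq norm_minus_commute)
  moreover have "\<bar>w x\<bar> \<le> (norm x)\<^sup>2 + drift_bound / h" for x
  proof -
    obtain z where "z \<in> Z" using Z(2) by auto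
    then have "- ((norm x)\<^sup>2 + drift_bound / h) \<le> w x" using Zb[of z x] upper[of z x] by linarith
    moreover have "w x \<le> (norm x)\<^sup>2 + drift_bound / h" using Zb[of _ x] by (intro least) (auto simp: abs_le_iff)
    ultimately show ?thesis by linarith
  qed
  ultimately show ?thesis by (simp add: barrier_class_def w_def)
qed

lemma barrier_class_INF:
  assumes Z: "Z \<subseteq> barrier_class h" "Z \<noteq> {}"
  shows "(\<lambda>x. INF z\<in>Z. z x) \<in> barrier_class h"
proof -
  have neg: "(\<lambda>x. - z x) \<in> barrier_class h" if "z \<in> barrier_class h" for z
    using that by (simp add: barrier_class_def lip_def abs_minus_commute)
  have "(\<lambda>x. SUP z\<in>(\<lambda>z x. - z x) ` Z. z x) \<in> barrier_class h"
    using Z neg by (intro barrier_class_SUP) auto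
  then have "(\<lambda>x. - (SUP z\<in>Z. - z x)) \<in> barrier_class h"
    using neg by (fastforce simp: image_image)
  then show ?thesis by (simp add: Inf_real_def image_image)
qed

text \<open>
  If \<open>w\<close> is a fixed point, subtracting the constant \<open>w 0\<close> on both sides leaves \<open>h\<^sup>2 w 0\<close> because
  of the discount, so that \<open>h w 0\<close> takes the role of the ergodic constant.
\<close>

lemma discrete_ergodic_solution:
  assumes h: "small h"
  obtains v r where "lip v" "v 0 = 0" "\<bar>r\<bar> \<le> drift_bound" "\<And>x. v x + h * r = step h v x"
proof -
  have h0: "0 < h" using h by (simp add: small_def)
  obtain w where w: "w \<in> barrier_class h" and fix_w: "step h w = w"
  proof (rule knaster_tarski_pointwise[of "barrier_class h" "\<lambda>x. - ((norm x)\<^sup>2 + drift_bound / h)"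
        "\<lambda>x. (norm x)\<^sup>2 + drift_bound / h" "step h"])
    have "(\<lambda>_. 0) \<in> barrier_class h"
      using drift_bound_nonneg h0 L_nonneg by (simp add: barrier_class_def lip_def)
    then show "barrier_class h \<noteq> {}" by auto
    show "- ((norm x)\<^sup>2 + drift_bound / h) \<le> z x" "z x \<le> (norm x)\<^sup>2 + drift_bound / h" if "z \<in> barrier_class h" for z x
    proof -
      have "\<bar>z x\<bar> \<le> (norm x)\<^sup>2 + drift_bound / h" using that by (simp add: barrier_class_def)
      then show "- ((norm x)\<^sup>2 + drift_bound / h) \<le> z x" "z x \<le> (norm x)\<^sup>2 + drift_bound / h" by linarith+
    qed
    show "step h z x \<le> step h z' x"
      if "z \<in> barrier_class h" "z' \<in> barrier_class h" "\<And>y. z y \<le> z' y" for z z' x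
      using that by (intro step_mono[OF h]) (simp_all add: barrier_class_def)
  qed (rule barrier_class_SUP barrier_class_INF step_barrier_class[OF h]; assumption)+
  define v where "v = (\<lambda>x. w x - w 0)"
  have wl: "lip w" using w by (simp add: barrier_class_def)
  then have vl: "lip v" by (simp add: lip_def v_def)
  let ?F = "\<lambda>w a x. walk h (\<lambda>y. (1 - h\<^sup>2) * w y) x a + h * f x a"
  have eq: "?F w a x = ?F v a x + (1 - h\<^sup>2) * w 0" for a x
  proof -
    have "(\<lambda>y. (1 - h\<^sup>2) * w y) = (\<lambda>y. (1 - h\<^sup>2) * v y + (1 - h\<^sup>2) * w 0)"
      by (simp add: v_def algebra_simps)
    then show ?thesis by (simp add: walk_def walk_mean_add walk_mean_const)
  qed
  have bd: "bounded ((\<lambda>a. ?F w a x) ` I)" "bounded ((\<lambda>a. ?F v a x) ` I)" for x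
    using walk_bounded lip_discount h h0 wl vl by blast+
  have "step h w x = step h v x + (1 - h\<^sup>2) * w 0" for x
  proof (rule antisym)
    show "step h w x \<le> step h v x + (1 - h\<^sup>2) * w 0"
      unfolding step_def by (rule value_le[OF bd]) (simp add: eq)
    have "step h v x \<le> step h w x + - ((1 - h\<^sup>2) * w 0)"
      unfolding step_def by (rule value_le[OF bd(2) bd(1)]) (simp add: eq)
    then show "step h v x + (1 - h\<^sup>2) * w 0 \<le> step h w x" by simp
  qed
  then have "v x + h * (h * w 0) = step h v x" for x
    by (simp add: fix_w v_def algebra_simps power2_eq_square)
  moreover have "\<bar>w 0\<bar> \<le> drift_bound / h" using w by (auto simp: barrier_class_def dest: spec[of _ 0])
  then have "\<bar>h * w 0\<bar> \<le> drift_bound" using h0 by (simp add: abs_mult field_simps)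
  ultimately show thesis using vl that[of v "h * w 0"] by (simp add: v_def)
qed

section \<open>Consistency in the limit of vanishing step\<close>

lemma trace_bound:
  fixes S S' :: "'a ^ 'd" and Q :: "'a \<Rightarrow> 'a \<Rightarrow> real"
  assumes N: "0 \<le> N" "\<And>y z. \<bar>Q y z\<bar> \<le> norm y * norm z * N"
  shows "\<bar>\<Sum>j\<in>UNIV. Q (S $ j) (S' $ j)\<bar> \<le> CARD('d) * (norm S * norm S' * N)"
proof -
  have "\<bar>Q (S $ j) (S' $ j)\<bar> \<le> norm S * norm S' * N" for j
    by (rule order_trans[OF N(2)])
       (intro mult_right_mono mult_mono Finite_Cartesian_Product.norm_nth_le N(1) norm_ge_zero)
  then show ?thesis
    by (intro order_trans[OF sum_abs] order_trans[OF sum_bounded_above]) auto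
qed

lemma hamiltonian_bounded:
  fixes Q :: "'a \<Rightarrow> 'a \<Rightarrow> real"
  assumes Q: "bounded_bilinear Q"
  shows "bounded ((\<lambda>a. (\<Sum>j\<in>UNIV. Q (s x a $ j) (s x a $ j)) + b x a \<bullet> p + f x a) ` I)"
proof -
  obtain N where N: "0 \<le> N" "\<And>y z. \<bar>Q y z\<bar> \<le> norm y * norm z * N"
    using bounded_bilinear.nonneg_bounded[OF Q] by auto
  define \<beta> where "\<beta> = Cb * norm x + B"
  define \<tau> where "\<tau> = Cs * norm x + B"
  have nn: "0 \<le> \<tau>" using nonneg by (simp add: \<tau>_def)
  show ?thesis
  proof (rule boundedI[of _ "CARD('d) * (\<tau> * \<tau> * N) + \<beta> * norm p + (Cf * norm x + B)"], elim imageE)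
    fix y a assume a: "a \<in> I" and y: "y = (\<Sum>j\<in>UNIV. Q (s x a $ j) (s x a $ j)) + b x a \<bullet> p + f x a"
    have le: "norm (b x a) \<le> \<beta>" "norm (s x a) \<le> \<tau>"
      using b_bound[OF a, of x] s_bound[OF a, of x] by (simp_all add: \<beta>_def \<tau>_def)
    have drift: "\<bar>b x a \<bullet> p\<bar> \<le> \<beta> * norm p"
      by (rule order_trans[OF Cauchy_Schwarz_ineq2]) (intro mult_right_mono le norm_ge_zero)
    have diffusion: "\<bar>\<Sum>j\<in>UNIV. Q (s x a $ j) (s x a $ j)\<bar> \<le> CARD('d) * (\<tau> * \<tau> * N)"
      by (rule order_trans[OF trace_bound[of N Q, OF N]])
         (intro mult_left_mono mult_right_mono mult_mono le N(1) nn norm_ge_zero; simp)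
    show "norm y \<le> CARD('d) * (\<tau> * \<tau> * N) + \<beta> * norm p + (Cf * norm x + B)"
      unfolding y real_norm_def
      by (rule order_trans[OF abs_triangle_ineq
            add_mono[OF order_trans[OF abs_triangle_ineq add_mono[OF diffusion drift]] f_bound[OF a]]])
  qed
qed

text \<open>
  Strictness of the touching (the constant \<open>\<eta>\<close>) forces the maximum points \<open>X n\<close> of the approximate
  functions minus the quadratic polynomial \<open>P\<close> to converge to \<open>x\<close>. In the scheme at
  \<open>X n\<close> monotonicity allows replacing \<open>v n\<close> by \<open>P\<close> plus a constant, as long as the walk stays in the
  ball where this dominates \<open>v n\<close>; for large \<open>n\<close> it does, its increments being of order \<open>sqrt h\<close>. The mean of \<open>P\<close> is exact,
  and the coefficients at \<open>X n\<close> differ from those at \<open>x\<close> by at most a multiple of \<open>|X n - x|\<close>.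
\<close>

lemma limit_subsolution_strict:
  fixes v :: "nat \<Rightarrow> 'a \<Rightarrow> real" and Q :: "'a \<Rightarrow> 'a \<Rightarrow> real"
  assumes h: "\<And>n. small (h n)" "h \<longlonglongrightarrow> 0"
    and v: "\<And>n. lip (v n)" "\<And>n. v n 0 = 0"
    and scheme: "\<And>n x. v n x + h n * r n \<le> step (h n) (v n) x"
    and r: "r \<longlonglongrightarrow> \<rho>"
    and lim: "\<And>x. (\<lambda>n. v n x) \<longlonglongrightarrow> w x"
    and Q: "bounded_bilinear Q" and pos: "0 < \<eta>" "0 < \<delta>"
    and touch: "\<And>y. norm (y - x) \<le> \<delta> \<Longrightarrow>
        w y + \<eta> * (norm (y - x))\<^sup>2 \<le> w x + p \<bullet> (y - x) + Q (y - x) (y - x)"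
  shows "\<rho> \<le> G (\<lambda>a. (\<Sum>j\<in>UNIV. Q (s x a $ j) (s x a $ j)) + b x a \<bullet> p + f x a)"
proof -
  interpret Q: bounded_bilinear Q by (rule Q)
  obtain N where N: "0 \<le> N" "\<And>y z. \<bar>Q y z\<bar> \<le> norm y * norm z * N"
    using Q.nonneg_bounded by auto
  define P where "P = (\<lambda>y. p \<bullet> (y - x) + Q (y - x) (y - x))"
  \<comment> \<open>All coefficients are estimated on the ball around \<open>x\<close>, where \<open>|y| \<le> R\<close>, \<open>|b| \<le> \<beta>\<close> and \<open>|s| \<le> \<tau>\<close>.\<close>
  define R where "R = norm x + \<delta>"
  define \<beta> where "\<beta> = Cb * R + B"
  define \<tau> where "\<tau> = Cs * R + B"
  have nn: "0 \<le> R" "0 \<le> \<beta>" "0 \<le> \<tau>"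
    using pos nonneg by (auto simp: R_def \<beta>_def \<tau>_def)
  have hpos: "0 < h n" "h n \<le> 1" for n using h(1)[of n] by (auto simp: small_def)
  have in_R: "norm y \<le> R" if "y \<in> cball x \<delta>" for y
    using that norm_triangle_sub[of y x] by (simp add: R_def dist_norm norm_minus_commute)
  have vlip: "\<bar>v n y - v n z\<bar> \<le> L * norm (y - z)" for n y z using v(1) by (simp add: lip_def)
  have v_bound: "\<bar>v n y\<bar> \<le> L * R" if "y \<in> cball x \<delta>" for n y
    using vlip[of n y 0] v(2) mult_left_mono[OF in_R[OF that] L_nonneg] by simp
  have "continuous_on (cball x \<delta>) (\<lambda>y. v n y - P y)" for n
  proof -
    have "continuous_on (cball x \<delta>) (v n)"
      using vlip L_nonneg
      by (intro lipschitz_on_continuous_on[of L] lipschitz_onI) (simp_all add: dist_norm)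
    then show ?thesis
      unfolding P_def by (intro continuous_intros Q.continuous_on)
  qed
  then have "\<exists>X\<in>cball x \<delta>. \<forall>y\<in>cball x \<delta>. v n y - P y \<le> v n X - P X" for n
    using pos by (intro continuous_attains_sup) auto
  then obtain X where X: "\<And>n. X n \<in> cball x \<delta>"
      "\<And>n y. y \<in> cball x \<delta> \<Longrightarrow> v n y - P y \<le> v n (X n) - P (X n)"
    by metis
  have X_lim: "(\<lambda>n. norm (X n - x)) \<longlonglongrightarrow> 0"
  proof (rule LIMSEQ_I)
    fix e :: real assume e: "0 < e"
    have "uniform_limit (cball x \<delta>) v w sequentially"
      by (rule lipschitz_limit_uniform_on_cball(2)[OF vlip lim])
    then have "\<forall>\<^sub>F n in sequentially. \<forall>y\<in>cball x \<delta>. dist (v n y) (w y) < \<eta> * e\<^sup>2 / 4"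
      using e pos by (intro uniform_limitD) auto
    then obtain n0 where n0: "\<And>n y. n \<ge> n0 \<Longrightarrow> y \<in> cball x \<delta> \<Longrightarrow> \<bar>v n y - w y\<bar> < \<eta> * e\<^sup>2 / 4"
      unfolding eventually_sequentially dist_real_def by blast
    have "norm (norm (X n - x) - 0) < e" if n: "n \<ge> n0" for n
    proof -
      have "norm (X n - x) \<le> \<delta>" using X(1)[of n] by (simp add: dist_norm norm_minus_commute)
      then have "w (X n) + \<eta> * (norm (X n - x))\<^sup>2 \<le> w x + P (X n)"
        using touch[of "X n"] by (simp add: P_def)
      moreover have "v n x \<le> v n (X n) - P (X n)"
        using X(2)[of x n] pos by (simp add: P_def Q.zero_left)
      moreover have "\<bar>v n x - w x\<bar> < \<eta> * e\<^sup>2 / 4" using n0[OF n, of x] pos by simp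
      moreover note n0[OF n X(1)[of n]]
      ultimately have "\<eta> * (norm (X n - x))\<^sup>2 < \<eta> * e\<^sup>2 / 2" by linarith
      also have "\<dots> \<le> \<eta> * e\<^sup>2" using pos e by simp
      finally have "(norm (X n - x))\<^sup>2 < e\<^sup>2" using pos by simp
      then show ?thesis using e power2_less_imp_less by fastforce
    qed
    then show "\<exists>n0. \<forall>n\<ge>n0. norm (norm (X n - x) - 0) < e" by blast
  qed
  define F where "F = (\<lambda>a. (\<Sum>j\<in>UNIV. Q (s x a $ j) (s x a $ j)) + b x a \<bullet> p + f x a)"
  have F_bd: "bounded (F ` I)" unfolding F_def by (rule hamiltonian_bounded[OF Q])
  note trace_bound = trace_bound[of N Q, OF N]
  \<comment> \<open>Consistency error of the scheme at \<open>X n\<close>, relative to the Hamiltonian at \<open>x\<close> and divided by \<open>h\<close>.\<close>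
  define E where "E = (\<lambda>n. norm (X n - x) * (2 * N * \<beta> + norm p * Cb + 2 * CARD('d) * N * \<tau> * Cs + Cf)
      + h n * (N * \<beta>\<^sup>2 + L * R))"
  have E_lim: "E \<longlonglongrightarrow> 0"
    unfolding E_def by (rule tendsto_eq_intros X_lim h(2) refl | simp)+
  \<comment> \<open>Bound for the distance from \<open>x\<close> of a walk started at \<open>X n\<close>.\<close>
  define D where "D = (\<lambda>n. norm (X n - x) + (h n * \<beta> + sqrt (CARD('d) * h n) * \<tau>))"
  have D_lim: "D \<longlonglongrightarrow> 0"
    unfolding D_def by (rule tendsto_eq_intros X_lim h(2) refl | simp)+
  have "r n \<le> G F + E n" if D: "D n < \<delta>" for n
  proof -
    let ?X = "X n" and ?h = "h n"
    define z where "z = ?X - x"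
    have step_upper: "walk ?h (\<lambda>y. (1 - ?h\<^sup>2) * v n y) ?X a + ?h * f ?X a
        \<le> ?h * F a + (v n ?X + ?h * E n)" if a: "a \<in> I" for a
    proof -
      let ?b = "b ?X a" and ?S = "s ?X a"
      let ?e = "?X + ?h *\<^sub>R ?b"
      let ?tr = "\<lambda>S. \<Sum>j\<in>UNIV. Q (S $ j) (S $ j)"
      have le: "norm (b y a) \<le> \<beta>" "norm (s y a) \<le> \<tau>" if "y \<in> cball x \<delta>" for y
        using b_bound[OF a, of y] s_bound[OF a, of y] in_R[OF that]
          mult_left_mono[OF in_R[OF that]] nonneg unfolding \<beta>_def \<tau>_def by (meson add_right_mono order_trans)+
      note leX = le[OF X(1)[of n]]
      have "walk ?h (\<lambda>y. (1 - ?h\<^sup>2) * v n y) ?X a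
          \<le> walk_mean ?h (\<lambda>y. P y + (v n ?X - P ?X + ?h\<^sup>2 * (L * R))) ?e ?S"
        unfolding walk_def
      proof (rule walk_mean_le)
        fix j and c :: real assume c: "\<bar>c\<bar> = sqrt (CARD('d) * ?h)"
        let ?y = "?e + c *\<^sub>R ?S $ j"
        have "norm (?y - x) \<le> norm z + (norm (?h *\<^sub>R ?b) + norm (c *\<^sub>R ?S $ j))"
        proof -
          have eq: "?y - x = z + (?h *\<^sub>R ?b + c *\<^sub>R ?S $ j)" by (simp add: z_def)
          show ?thesis
            unfolding eq
            by (rule order_trans[OF norm_triangle_ineq add_left_mono[OF norm_triangle_ineq]])
        qed
        also have "\<dots> \<le> D n"
        proof -
          have "norm (c *\<^sub>R ?S $ j) \<le> sqrt (CARD('d) * ?h) * \<tau>"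
            unfolding norm_scaleR c using leX(2) Finite_Cartesian_Product.norm_nth_le[of ?S j] hpos[of n]
            by (intro mult_left_mono) auto
          moreover have "norm (?h *\<^sub>R ?b) \<le> ?h * \<beta>" using leX(1) hpos[of n] by simp
          ultimately show ?thesis by (simp add: D_def z_def)
        qed
        finally have y: "?y \<in> cball x \<delta>" using D by (simp add: dist_norm norm_minus_commute)
        have "(1 - ?h\<^sup>2) * v n ?y \<le> v n ?y + ?h\<^sup>2 * (L * R)"
        proof -
          have "- v n ?y \<le> L * R" using v_bound[OF y, of n] by linarith
          from mult_left_mono[OF this, of "?h\<^sup>2"] show ?thesis by (simp add: algebra_simps)
        qed
        then show "(1 - ?h\<^sup>2) * v n ?y \<le> P ?y + (v n ?X - P ?X + ?h\<^sup>2 * (L * R))"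
          using X(2)[OF y, of n] by simp
      qed (use hpos[of n] in simp)
      also have "\<dots> = P ?e + ?h * ?tr ?S + (v n ?X - P ?X + ?h\<^sup>2 * (L * R))"
      proof -
        have "walk_mean ?h P ?e ?S = P ?e + ?h * ?tr ?S"
        proof -
          have *: "P = (\<lambda>y. (p \<bullet> y + - (p \<bullet> x)) + Q (y - x) (y - x))"
            by (simp add: P_def fun_eq_iff algebra_simps)
          have "walk_mean ?h (\<lambda>y. p \<bullet> y) ?e ?S = p \<bullet> ?e"
            by (rule walk_mean_linear) (simp_all add: inner_add_right)
          then show ?thesis
            unfolding *
            by (simp only: walk_mean_add walk_mean_const walk_mean_quadratic[OF Q less_imp_le[OF hpos(1)]])
        qed
        then show ?thesis by (simp add: walk_mean_add walk_mean_const)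
      qed
      also have "P ?e = P ?X + ?h * (?b \<bullet> p + (Q z ?b + Q ?b z) + ?h * Q ?b ?b)"
      proof -
        have "?e - x = z + ?h *\<^sub>R ?b" by (simp add: z_def)
        then show ?thesis
          by (simp add: P_def Q.add_left Q.add_right Q.scaleR_left Q.scaleR_right z_def[symmetric]
              inner_commute algebra_simps)
      qed
      finally have 1: "walk ?h (\<lambda>y. (1 - ?h\<^sup>2) * v n y) ?X a + ?h * f ?X a
          \<le> v n ?X + ?h * (?tr ?S + ?b \<bullet> p + f ?X a + (Q z ?b + Q ?b z) + ?h * (Q ?b ?b + L * R))"
        by (simp add: algebra_simps power2_eq_square)
      have x: "x \<in> cball x \<delta>" using pos by simp
      have "\<bar>Q z ?b\<bar> \<le> norm z * (N * \<beta>)" "\<bar>Q ?b z\<bar> \<le> norm z * (N * \<beta>)"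
      proof -
        have "norm z * norm ?b * N \<le> norm z * \<beta> * N"
          using leX(1) N(1) by (intro mult_right_mono mult_left_mono) auto
        then show "\<bar>Q z ?b\<bar> \<le> norm z * (N * \<beta>)" "\<bar>Q ?b z\<bar> \<le> norm z * (N * \<beta>)"
          using N(2)[of z ?b] N(2)[of ?b z] by (simp_all add: mult.commute mult.left_commute)
      qed
      then have 2: "Q z ?b + Q ?b z \<le> norm z * (2 * N * \<beta>)" by (simp add: abs_le_iff)
      have 3: "Q ?b ?b \<le> N * \<beta>\<^sup>2"
      proof -
        have "Q ?b ?b \<le> norm ?b * norm ?b * N" using N(2)[of ?b ?b] by linarith
        also have "\<dots> \<le> \<beta> * \<beta> * N"
          using leX(1) N(1) nn by (intro mult_right_mono mult_mono) auto
        finally show ?thesis by (simp add: power2_eq_square mult.commute)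
      qed
      have 4: "?b \<bullet> p \<le> b x a \<bullet> p + norm z * (norm p * Cb)"
      proof -
        have "(?b - b x a) \<bullet> p \<le> norm (?b - b x a) * norm p" by (rule norm_cauchy_schwarz)
        also have "\<dots> \<le> Cb * norm z * norm p"
          using b_lip[OF a, of ?X x] by (intro mult_right_mono) (auto simp: z_def)
        finally show ?thesis by (simp add: inner_diff_left algebra_simps)
      qed
      have 5: "?tr ?S \<le> ?tr (s x a) + norm z * (2 * CARD('d) * N * \<tau> * Cs)"
      proof -
        let ?T = "s x a"
        have ds: "norm (?S - ?T) \<le> Cs * norm z" using s_lip[OF a, of ?X x] by (simp add: z_def)
        have tb: "(\<Sum>j\<in>UNIV. Q (A $ j) (A' $ j)) \<le> CARD('d) * (norm z * N * \<tau> * Cs)"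
          if "norm A * norm A' \<le> (Cs * norm z) * \<tau>" for A A' :: "'a ^ 'd"
        proof -
          have le: "CARD('d) * (norm A * norm A' * N) \<le> CARD('d) * ((Cs * norm z) * \<tau> * N)"
            by (rule mult_left_mono[OF mult_right_mono[OF that N(1)] of_nat_0_le_iff])
          have eq: "(Cs * norm z) * \<tau> * N = norm z * N * \<tau> * Cs" by (simp only: ac_simps)
          from order_trans[OF order_trans[OF abs_ge_self trace_bound[of A A']] le]
          show ?thesis unfolding eq .
        qed
        have "?tr ?S - ?tr ?T = (\<Sum>j\<in>UNIV. Q ((?S - ?T) $ j) (?S $ j)) + (\<Sum>j\<in>UNIV. Q (?T $ j) ((?S - ?T) $ j))"
          by (simp add: Q.diff_left Q.diff_right sum_subtractf)
        also have "\<dots> \<le> CARD('d) * (norm z * N * \<tau> * Cs) + CARD('d) * (norm z * N * \<tau> * Cs)"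
        proof (intro add_mono tb)
          show "norm (?S - ?T) * norm ?S \<le> Cs * norm z * \<tau>"
            by (intro mult_mono ds leX(2) mult_nonneg_nonneg nonneg norm_ge_zero)
          show "norm ?T * norm (?S - ?T) \<le> Cs * norm z * \<tau>"
            unfolding mult.commute[of "norm ?T"]
            by (intro mult_mono ds le(2)[OF x] mult_nonneg_nonneg nonneg norm_ge_zero)
        qed
        finally show ?thesis by (simp add: algebra_simps)
      qed
      have 6: "f ?X a \<le> f x a + norm z * Cf"
        using f_lip[OF a, of ?X x] by (simp add: z_def abs_le_iff algebra_simps)
      have "?h * (Q ?b ?b + L * R) \<le> ?h * (N * \<beta>\<^sup>2 + L * R)"
        using 3 hpos[of n] by simp
      then have "?tr ?S + ?b \<bullet> p + f ?X a + (Q z ?b + Q ?b z) + ?h * (Q ?b ?b + L * R) \<le> F a + E n"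
        using 2 4 5 6 unfolding F_def E_def z_def[symmetric] distrib_left by linarith
      then have "?h * (?tr ?S + ?b \<bullet> p + f ?X a + (Q z ?b + Q ?b z) + ?h * (Q ?b ?b + L * R))
          \<le> ?h * (F a + E n)"
        using hpos[of n] by (intro mult_left_mono) auto
      then show ?thesis using 1 unfolding distrib_left by linarith
    qed
    have hF: "bounded ((\<lambda>a. ?h * F a) ` I)"
      using bounded_scaling[OF F_bd, of ?h] by (simp add: image_image)
    have "v n ?X + ?h * r n \<le> step ?h (v n) ?X" by (rule scheme)
    also have "\<dots> \<le> G (\<lambda>a. ?h * F a) + (v n ?X + ?h * E n)"
      unfolding step_def using step_upper hF h(1)[of n] v(1) hpos[of n]
      by (intro value_le walk_bounded lip_discount) auto
    also have "G (\<lambda>a. ?h * F a) = ?h * G F" by (rule value_scale[OF F_bd hpos(1)])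
    finally have "?h * r n \<le> ?h * (G F + E n)" by (simp add: distrib_left)
    then show ?thesis using hpos[of n] by simp
  qed
  moreover have "\<forall>\<^sub>F n in sequentially. D n < \<delta>"
    using order_tendstoD(2)[OF D_lim pos(2)] .
  ultimately have "\<forall>\<^sub>F n in sequentially. r n \<le> G F + E n" by (auto elim: eventually_mono)
  moreover have "(\<lambda>n. G F + E n) \<longlonglongrightarrow> G F" using tendsto_add[OF tendsto_const E_lim, of "G F"] by simp
  ultimately have "\<rho> \<le> G F" using r by (intro tendsto_le[OF sequentially_bot])
  then show ?thesis by (simp add: F_def)
qed

text \<open>
  Touching up to \<open>\<eta> |y - x|\<^sup>2\<close> from above becomes strict touching after adding \<open>2 \<eta> |y - x|\<^sup>2\<close> to
  the quadratic form, which changes the Hamiltonian by \<open>O(\<eta>)\<close>.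
\<close>

lemma limit_subsolution:
  fixes v :: "nat \<Rightarrow> 'a \<Rightarrow> real" and Q :: "'a \<Rightarrow> 'a \<Rightarrow> real"
  assumes h: "\<And>n. small (h n)" "h \<longlonglongrightarrow> 0"
    and v: "\<And>n. lip (v n)" "\<And>n. v n 0 = 0"
    and scheme: "\<And>n x. v n x + h n * r n \<le> step (h n) (v n) x"
    and r: "r \<longlonglongrightarrow> \<rho>"
    and lim: "\<And>x. (\<lambda>n. v n x) \<longlonglongrightarrow> w x"
    and Q: "bounded_bilinear Q"
    and touch: "\<And>\<eta>. 0 < \<eta> \<Longrightarrow> \<exists>\<delta>>0. \<forall>y. norm (y - x) \<le> \<delta> \<longrightarrow>
        w y \<le> w x + p \<bullet> (y - x) + Q (y - x) (y - x) + \<eta> * (norm (y - x))\<^sup>2"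
  shows "\<rho> \<le> G (\<lambda>a. (\<Sum>j\<in>UNIV. Q (s x a $ j) (s x a $ j)) + b x a \<bullet> p + f x a)"
proof -
  let ?F = "\<lambda>Q a. (\<Sum>j\<in>UNIV. Q (s x a $ j) (s x a $ j)) + b x a \<bullet> p + f x a"
  let ?T = "(Cs * norm x + B)\<^sup>2"
  have perturbed: "\<rho> \<le> G (?F Q) + 2 * \<eta> * ?T" if \<eta>: "0 < \<eta>" for \<eta>
  proof -
    obtain \<delta> where \<delta>: "0 < \<delta>" "\<And>y. norm (y - x) \<le> \<delta> \<Longrightarrow>
        w y \<le> w x + p \<bullet> (y - x) + Q (y - x) (y - x) + \<eta> * (norm (y - x))\<^sup>2"
      using touch[OF \<eta>] by blast
    define Q' where "Q' = (\<lambda>y z. Q y z + 2 * \<eta> * (y \<bullet> z))"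
    have Q': "bounded_bilinear Q'"
      using bounded_bilinear_combination[OF Q bounded_bilinear_inner, of 1 "2 * \<eta>"] by (simp add: Q'_def)
    have "\<rho> \<le> G (?F Q')"
    proof (rule limit_subsolution_strict[OF h v scheme r lim Q' \<eta> \<delta>(1)])
      fix y assume "norm (y - x) \<le> \<delta>"
      from \<delta>(2)[OF this]
      show "w y + \<eta> * (norm (y - x))\<^sup>2 \<le> w x + p \<bullet> (y - x) + Q' (y - x) (y - x)"
        by (simp add: Q'_def power2_norm_eq_inner)
    qed
    also have "G (?F Q') \<le> G (?F Q) + 2 * \<eta> * ?T"
    proof (rule value_le[OF hamiltonian_bounded[OF Q'] hamiltonian_bounded[OF Q]])
      fix a assume a: "a \<in> I"
      have "(\<Sum>j\<in>UNIV. Q' (s x a $ j) (s x a $ j))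
          = (\<Sum>j\<in>UNIV. Q (s x a $ j) (s x a $ j)) + 2 * \<eta> * (norm (s x a))\<^sup>2"
        by (simp add: Q'_def sum.distrib power2_norm_eq_inner inner_vec_def sum_distrib_left)
      moreover have "(norm (s x a))\<^sup>2 \<le> ?T" using s_bound[OF a] by (intro power_mono) auto
      ultimately show "?F Q' a \<le> ?F Q a + 2 * \<eta> * ?T" using \<eta> by simp
    qed
    finally show ?thesis .
  qed
  show ?thesis
  proof (rule field_le_epsilon)
    fix e :: real assume e: "0 < e"
    define T where "T = ?T"
    have T: "0 \<le> T" by (simp add: T_def)
    define \<eta> where "\<eta> = e / (2 * (T + 1))"
    have \<eta>: "0 < \<eta>" using e T by (simp add: \<eta>_def)
    have "2 * \<eta> * T \<le> 2 * \<eta> * (T + 1)" using \<eta> by simp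
    also have "\<dots> = e" using T by (simp add: \<eta>_def field_simps)
    finally show "\<rho> \<le> G (?F Q) + e" using perturbed[OF \<eta>] by (simp add: T_def)
  qed
qed

section \<open>Existence for an abstract value functional\<close>

lemma small_sequence:
  obtains h where "\<And>n. small (h n)" "h \<longlonglongrightarrow> 0"
proof -
  \<comment> \<open>The three entries enforce the three upper bounds on the step; adding \<open>1\<close> covers \<open>Cb = 0\<close>.\<close>
  define h0 where "h0 = min (1 / 2) (min (1 / \<kappa>) (\<kappa> / (Cb\<^sup>2 + 1)))"
  have C: "0 < Cb\<^sup>2 + 1" using zero_le_power2[of Cb] by linarith
  have h0: "0 < h0" using kappa_pos C by (simp add: h0_def)
  have "small (h0 * inverse (real (Suc n)))" for n
  proof -
    let ?h = "h0 * inverse (real (Suc n))"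
    have "?h \<le> h0" using h0 by (intro mult_right_le_one_le) (simp_all add: inverse_le_1_iff)
    then have le: "?h \<le> 1 / 2" "?h \<le> 1 / \<kappa>" "?h \<le> \<kappa> / (Cb\<^sup>2 + 1)" by (auto simp: h0_def)
    have pos: "0 < ?h" using h0 by simp
    have "?h * Cb\<^sup>2 \<le> ?h * (Cb\<^sup>2 + 1)" using pos by (intro mult_left_mono) auto
    also have "\<dots> \<le> \<kappa>" using le(3) C by (simp only: pos_le_divide_eq)
    finally show ?thesis
      using le(1,2) pos kappa_pos unfolding small_def by (simp only: pos_le_divide_eq)
  qed
  moreover have "(\<lambda>n. h0 * inverse (real (Suc n))) \<longlonglongrightarrow> 0"
    by (rule tendsto_mult_right_zero[OF LIMSEQ_inverse_real_of_nat])
  ultimately show thesis by (rule that)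
qed

text \<open>
  Compactness: neither the Lipschitz constant of the discrete solutions nor the bound on the numbers
  \<open>r\<close> depends on the step.
\<close>

lemma convergent_discrete_solutions:
  obtains h v r \<rho> w where "\<And>n. small (h n)" "h \<longlonglongrightarrow> 0" "\<And>n. lip (v n)" "\<And>n. v n 0 = 0"
    "\<And>n x. v n x + h n * r n = step (h n) (v n) x" "r \<longlonglongrightarrow> \<rho>" "\<And>x. (\<lambda>n. v n x) \<longlonglongrightarrow> w x"
proof -
  obtain h where h: "\<And>n. small (h n)" "h \<longlonglongrightarrow> 0" using small_sequence by blast
  have "\<exists>v r. lip v \<and> v 0 = 0 \<and> \<bar>r\<bar> \<le> drift_bound \<and> (\<forall>x. v x + h n * r = step (h n) v x)" for n
    by (rule discrete_ergodic_solution[OF h(1)[of n]]) blast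
  then obtain v r where v: "\<And>n. lip (v n)" "\<And>n. v n 0 = 0" and r: "\<And>n. \<bar>r n\<bar> \<le> drift_bound"
      and eq: "\<And>n x. v n x + h n * r n = step (h n) (v n) x"
    by metis
  have "bounded (range r)" using r by (intro boundedI) auto
  then obtain \<rho> k where k: "strict_mono (k :: nat \<Rightarrow> nat)" and \<rho>: "(r \<circ> k) \<longlonglongrightarrow> \<rho>"
    using bounded_imp_convergent_subsequence by blast
  have "\<bar>v (k n) x - v (k n) y\<bar> \<le> L * norm (x - y)" for n x y using v(1) by (simp add: lip_def)
  then obtain l w where l: "strict_mono (l :: nat \<Rightarrow> nat)" and w: "\<And>x. (\<lambda>n. v (k (l n)) x) \<longlonglongrightarrow> w x"
    using lipschitz_subsequence_converges[of "\<lambda>n. v (k n)" L] v(2) by metis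
  define m where "m = k \<circ> l"
  have m: "strict_mono m" unfolding m_def using k l by (rule strict_mono_o)
  show thesis
  proof (rule that[of "h \<circ> m" "v \<circ> m" "r \<circ> m" \<rho> w])
    show "(r \<circ> m) \<longlonglongrightarrow> \<rho>" using LIMSEQ_subseq_LIMSEQ[OF \<rho> l] by (simp add: m_def o_assoc)
    show "(h \<circ> m) \<longlonglongrightarrow> 0" by (rule LIMSEQ_subseq_LIMSEQ[OF h(2) m])
  qed (use h(1) v eq w in \<open>auto simp: m_def\<close>)
qed

end

text \<open>
  The two properties of \<open>w\<close> are the viscosity inequalities in terms of second-order jets \<open>(p, Q)\<close>,
  where \<open>Q\<close> corresponds to one half of the Hessian. The second one is the first for the dual game.
\<close>

lemma ergodic_solution:
  fixes G :: "('c \<Rightarrow> real) \<Rightarrow> real" and b :: "'a::euclidean_space \<Rightarrow> 'c \<Rightarrow> 'a"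
    and s :: "'a \<Rightarrow> 'c \<Rightarrow> 'a ^ 'd"
  assumes game: "dissipative_game I G b s f Cb Cf Cs K B"
  obtains \<rho> w C where "0 \<le> C" "\<And>x y. \<bar>w x - w y\<bar> \<le> C * norm (x - y)" "w 0 = 0"
    "\<And>x p Q. bounded_bilinear Q \<Longrightarrow>
       (\<And>\<eta>. 0 < \<eta> \<Longrightarrow> \<exists>\<delta>>0. \<forall>y. norm (y - x) \<le> \<delta> \<longrightarrow>
         w y \<le> w x + p \<bullet> (y - x) + Q (y - x) (y - x) + \<eta> * (norm (y - x))\<^sup>2) \<Longrightarrow>
       \<rho> \<le> G (\<lambda>a. (\<Sum>j\<in>UNIV. Q (s x a $ j) (s x a $ j)) + b x a \<bullet> p + f x a)"
    "\<And>x p Q. bounded_bilinear Q \<Longrightarrow>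
       (\<And>\<eta>. 0 < \<eta> \<Longrightarrow> \<exists>\<delta>>0. \<forall>y. norm (y - x) \<le> \<delta> \<longrightarrow>
         w y \<ge> w x + p \<bullet> (y - x) + Q (y - x) (y - x) - \<eta> * (norm (y - x))\<^sup>2) \<Longrightarrow>
       \<rho> \<ge> G (\<lambda>a. (\<Sum>j\<in>UNIV. Q (s x a $ j) (s x a $ j)) + b x a \<bullet> p + f x a)"
proof -
  obtain h v r \<rho> w where h: "\<And>n. small Cb Cs K (h n)" "h \<longlonglongrightarrow> 0"
      and v: "\<And>n. lip Cf Cs K (v n)" "\<And>n. v n 0 = 0"
      and eq: "\<And>n x. v n x + h n * r n = step G b s f (h n) (v n) x"
      and r: "r \<longlonglongrightarrow> \<rho>" and lim: "\<And>x. (\<lambda>n. v n x) \<longlonglongrightarrow> w x"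
    by (rule convergent_discrete_solutions[OF game]) blast
  show thesis
  proof (rule that)
    show "0 \<le> L Cf Cs K" by (rule L_nonneg[OF game])
    show "\<bar>w x - w y\<bar> \<le> L Cf Cs K * norm (x - y)" for x y
      using lipschitz_limit_uniform_on_cball(1)[of v "L Cf Cs K" w, OF _ lim] v(1) by (simp add: lip_def[OF game])
    show "w 0 = 0" using lim[of 0] v(2) by (simp add: LIMSEQ_const_iff)
  next
    fix x p and Q :: "'a \<Rightarrow> 'a \<Rightarrow> real"
    assume Q: "bounded_bilinear Q" and touch: "\<And>\<eta>. 0 < \<eta> \<Longrightarrow> \<exists>\<delta>>0. \<forall>y. norm (y - x) \<le> \<delta> \<longrightarrow>
         w y \<le> w x + p \<bullet> (y - x) + Q (y - x) (y - x) + \<eta> * (norm (y - x))\<^sup>2"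
    show "\<rho> \<le> G (\<lambda>a. (\<Sum>j\<in>UNIV. Q (s x a $ j) (s x a $ j)) + b x a \<bullet> p + f x a)"
      by (rule limit_subsolution[OF game h v _ r lim Q touch]) (simp_all add: eq)
  next
    fix x p and Q :: "'a \<Rightarrow> 'a \<Rightarrow> real"
    assume Q: "bounded_bilinear Q" and touch: "\<And>\<eta>. 0 < \<eta> \<Longrightarrow> \<exists>\<delta>>0. \<forall>y. norm (y - x) \<le> \<delta> \<longrightarrow>
         w y \<ge> w x + p \<bullet> (y - x) + Q (y - x) (y - x) - \<eta> * (norm (y - x))\<^sup>2"
    have walk_neg: "walk b s h' (\<lambda>y. c * - u y) x a = - walk b s h' (\<lambda>y. c * u y) x a" for h' c u x a
      using walk_mean_cmult[of h' "-1" "\<lambda>y. c * u y"] by (simp add: walk_def[OF game])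
    have "- \<rho> \<le> - G (\<lambda>a. - ((\<Sum>j\<in>UNIV. - Q (s x a $ j) (s x a $ j)) + b x a \<bullet> (- p) + - f x a))"
    proof (rule limit_subsolution[OF dissipative_game_dual[OF game], where h = h
          and v = "\<lambda>n y. - v n y" and r = "\<lambda>n. - r n" and w = "\<lambda>y. - w y" and Q = "\<lambda>y z. - Q y z"])
      show "bounded_bilinear (\<lambda>y z. - Q y z)" using bounded_bilinear_combination[OF Q Q, of "-1" 0] by simp
      show "- v n x + h n * - r n
          \<le> step (\<lambda>F. - G (\<lambda>a. - F a)) b s (\<lambda>x a. - f x a) (h n) (\<lambda>y. - v n y) x" for n x
      proof -
        have "step (\<lambda>F. - G (\<lambda>a. - F a)) b s (\<lambda>x a. - f x a) (h n) (\<lambda>y. - v n y) x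
            = - step G b s f (h n) (v n) x"
          unfolding step_def[OF game] step_def[OF dissipative_game_dual[OF game]] walk_neg by (simp add: add.commute)
        then show ?thesis using eq[of n x] by simp
      qed
      show "\<exists>\<delta>>0. \<forall>y. norm (y - x) \<le> \<delta> \<longrightarrow>
         - w y \<le> - w x + (- p) \<bullet> (y - x) + - Q (y - x) (y - x) + \<eta> * (norm (y - x))\<^sup>2"
        if "0 < \<eta>" for \<eta> using touch[OF that] by (simp add: algebra_simps)
      show "(\<lambda>n. - v n x) \<longlonglongrightarrow> - w x" for x by (intro tendsto_minus lim)
      show "(\<lambda>n. - r n) \<longlonglongrightarrow> - \<rho>" by (intro tendsto_minus r)
    qed (use h v in \<open>auto simp: lip_def[OF game] abs_minus_commute\<close>)
    then show "\<rho> \<ge> G (\<lambda>a. (\<Sum>j\<in>UNIV. Q (s x a $ j) (s x a $ j)) + b x a \<bullet> p + f x a)"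
      by (simp add: sum_negf algebra_simps)
  qed
qed
section \<open>The ergodic Isaacs equation\<close>

text \<open>
  Controls are pairs in \<open>U \<times> V\<close>, and compactness and continuity are used to bound the coefficients
  at the origin; with the Lipschitz conditions this bounds them at every point, uniformly in the
  controls. Transposing \<open>\<sigma>\<close> turns its columns into components of a vector and the trace norm into
  the Euclidean norm.
\<close>

theorem theorem3p1:
  fixes U :: "'u::metric_space set" and V :: "'v::metric_space set"
    and b :: "real ^ 'n \<Rightarrow> 'u \<Rightarrow> 'v \<Rightarrow> real ^ 'n"
    and \<sigma> :: "real ^ 'n \<Rightarrow> 'u \<Rightarrow> 'v \<Rightarrow> real ^ 'd ^ 'n"
    and f :: "real ^ 'n \<Rightarrow> 'u \<Rightarrow> 'v \<Rightarrow> real"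
    and C\<^sub>b C\<^sub>f C\<^sub>\<sigma> K :: real
  assumes "compact U" "U \<noteq> {}" "compact V" "V \<noteq> {}"
    and "\<And>x. continuous_on (U \<times> V) (\<lambda>(u, v). b x u v)"
    and "\<And>x. continuous_on (U \<times> V) (\<lambda>(u, v). \<sigma> x u v)"
    and "\<And>x. continuous_on (U \<times> V) (\<lambda>(u, v). f x u v)"
    and "\<And>x y u v. u \<in> U \<Longrightarrow> v \<in> V \<Longrightarrow> norm (b x u v - b y u v) \<le> C\<^sub>b * norm (x - y)"
    and "\<And>x y u v. u \<in> U \<Longrightarrow> v \<in> V \<Longrightarrow> \<bar>f x u v - f y u v\<bar> \<le> C\<^sub>f * norm (x - y)"
    and "\<And>x y u v. u \<in> U \<Longrightarrow> v \<in> V \<Longrightarrow> trace_norm (\<sigma> x u v - \<sigma> y u v) \<le> C\<^sub>\<sigma> * norm (x - y)"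
    and "K > C\<^sub>\<sigma>\<^sup>2"
    and "\<And>x y u v. u \<in> U \<Longrightarrow> v \<in> V \<Longrightarrow>
           2 * ((x - y) \<bullet> (b x u v - b y u v)) \<le> - K * (norm (x - y))\<^sup>2"
  shows "\<exists>\<rho> w. continuous_on UNIV w \<and>
           viscosity_solution U V (hamiltonian b \<sigma> f) \<rho> w \<and>
           (\<exists>C>0. \<forall>x y. \<bar>w x - w y\<bar> \<le> C * norm (x - y) \<and> \<bar>w x\<bar> \<le> C * norm x)"
proof -
  have ne: "U \<noteq> {}" "V \<noteq> {}" and comp: "compact (U \<times> V)"
    using assms(1-4) by (auto intro: compact_Times)
  have bounds: "bounded ((\<lambda>(u, v). b 0 u v) ` (U \<times> V))" "bounded ((\<lambda>(u, v). \<sigma> 0 u v) ` (U \<times> V))"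
     "bounded ((\<lambda>(u, v). f 0 u v) ` (U \<times> V))"
    using comp assms(5-7) by (blast intro: compact_imp_bounded compact_continuous_image)+
  obtain B1 B2 B3 where B:
     "\<And>u v. u \<in> U \<Longrightarrow> v \<in> V \<Longrightarrow> norm (b 0 u v) \<le> B1"
     "\<And>u v. u \<in> U \<Longrightarrow> v \<in> V \<Longrightarrow> norm (\<sigma> 0 u v) \<le> B2"
     "\<And>u v. u \<in> U \<Longrightarrow> v \<in> V \<Longrightarrow> \<bar>f 0 u v\<bar> \<le> B3"
  proof -
    have "\<exists>B. \<forall>u\<in>U. \<forall>v\<in>V. norm (g u v) \<le> B" if "bounded ((\<lambda>(u, v). g u v) ` (U \<times> V))"
      for g :: "'u \<Rightarrow> 'v \<Rightarrow> 'w::real_normed_vector"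
      using that unfolding bounded_iff by fast
    from this[OF bounds(1)] this[OF bounds(2)] this[OF bounds(3)] that show thesis
      unfolding real_norm_def by metis
  qed
  obtain u0 v0 where uv0: "u0 \<in> U" "v0 \<in> V" using ne by auto
  obtain i :: 'n where "i \<in> UNIV" by simp
  have nn: "0 \<le> C\<^sub>b" "0 \<le> C\<^sub>f" "0 \<le> C\<^sub>\<sigma>"
    using order_trans[OF norm_ge_zero assms(8)[OF uv0, of "axis i 1" 0]]
      order_trans[OF abs_ge_zero assms(9)[OF uv0, of "axis i 1" 0]]
      order_trans[OF _ assms(10)[OF uv0, of "axis i 1" 0]]
    by (simp_all add: trace_norm_eq_norm)
  have "0 \<le> B1" using order_trans[OF norm_ge_zero B(1)[OF uv0]] .
  define B0 where "B0 = max B1 (max B2 B3)"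
  have game: "dissipative_game (U \<times> V) (upper_value U V) (\<lambda>x (u, v). b x u v)
      (\<lambda>x (u, v). transpose (\<sigma> x u v)) (\<lambda>x (u, v). f x u v) C\<^sub>b C\<^sub>f C\<^sub>\<sigma> K B0"
  proof -
    have "upper_value U V F \<le> upper_value U V F' + c"
      if "bounded (F ` (U \<times> V))" "bounded (F' ` (U \<times> V))" "\<forall>a\<in>U \<times> V. F a \<le> F' a + c"
      for F F' c
      using upper_value_le[OF ne that(1,2), of 1 c] that(3) by simp
    moreover have "norm (transpose (\<sigma> x u v) - transpose (\<sigma> y u v)) \<le> C\<^sub>\<sigma> * norm (x - y)"
      if "u \<in> U" "v \<in> V" for u v x y
    proof -
      have "transpose A - transpose A' = transpose (A - A')" for A A' :: "real ^ 'd ^ 'n"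
        by (simp add: transpose_def vec_eq_iff)
      then show ?thesis using assms(10)[OF that, of x y] by (simp add: trace_norm_eq_norm)
    qed
    moreover have "0 \<le> B0" using \<open>0 \<le> B1\<close> by (simp add: B0_def)
    moreover have "norm (b 0 u v) \<le> B0" "norm (transpose (\<sigma> 0 u v)) \<le> B0" "\<bar>f 0 u v\<bar> \<le> B0"
      if "u \<in> U" "v \<in> V" for u v
      using B[OF that] by (simp_all add: B0_def norm_transpose le_max_iff_disj)
    ultimately show ?thesis
      using upper_value_scale[OF ne] nn assms(8,9,11,12) unfolding dissipative_game_def by auto
  qed
  let ?S = "\<lambda>x a. case a of (u, v) \<Rightarrow> transpose (\<sigma> x u v)"
  let ?H = "\<lambda>x p Q a. (\<Sum>j\<in>UNIV. Q (?S x a $ j) (?S x a $ j))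
      + (case a of (u, v) \<Rightarrow> b x u v) \<bullet> p + (case a of (u, v) \<Rightarrow> f x u v)"
  obtain \<rho> w L where L: "0 \<le> L" and wl: "\<And>x y. \<bar>w x - w y\<bar> \<le> L * norm (x - y)" and w0: "w 0 = 0"
    and sub: "\<And>x p Q. bounded_bilinear Q \<Longrightarrow>
       (\<And>\<eta>. 0 < \<eta> \<Longrightarrow> \<exists>\<delta>>0. \<forall>y. norm (y - x) \<le> \<delta> \<longrightarrow>
         w y \<le> w x + p \<bullet> (y - x) + Q (y - x) (y - x) + \<eta> * (norm (y - x))\<^sup>2) \<Longrightarrow>
       \<rho> \<le> upper_value U V (?H x p Q)"
    and super: "\<And>x p Q. bounded_bilinear Q \<Longrightarrow>
       (\<And>\<eta>. 0 < \<eta> \<Longrightarrow> \<exists>\<delta>>0. \<forall>y. norm (y - x) \<le> \<delta> \<longrightarrow>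
         w y \<ge> w x + p \<bullet> (y - x) + Q (y - x) (y - x) - \<eta> * (norm (y - x))\<^sup>2) \<Longrightarrow>
       \<rho> \<ge> upper_value U V (?H x p Q)"
    by (rule ergodic_solution[OF game]) blast
  have form: "bounded_bilinear (\<lambda>y z. y \<bullet> (A *v z) / 2)" for A :: "real ^ 'n ^ 'n"
    using bounded_bilinear_combination[OF
        bounded_bilinear.comp[OF bounded_bilinear_inner bounded_linear_ident matrix_vector_mul_bounded_linear[of A]]
        bounded_bilinear_inner, of "1/2" 0] by simp
  have H: "upper_value U V (?H x p (\<lambda>y z. y \<bullet> (A *v z) / 2))
      = (INF u\<in>U. SUP v\<in>V. hamiltonian b \<sigma> f x p A u v)" for x p A
    by (simp add: upper_value_def hamiltonian_def trace_covariance sum_divide_distrib)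
  have "viscosity_subsolution U V (hamiltonian b \<sigma> f) \<rho> w"
    unfolding viscosity_subsolution_def H[symmetric]
    by (intro ballI allI impI sub form C3b_expansion_above)
  moreover have "viscosity_supersolution U V (hamiltonian b \<sigma> f) \<rho> w"
    unfolding viscosity_supersolution_def H[symmetric]
    by (intro ballI allI impI super form C3b_expansion_below)
  moreover have "continuous_on UNIV w"
    using wl L by (intro lipschitz_on_continuous_on[of L] lipschitz_onI) (simp_all add: dist_norm)
  moreover have "\<exists>C>0. \<forall>x y. \<bar>w x - w y\<bar> \<le> C * norm (x - y) \<and> \<bar>w x\<bar> \<le> C * norm x"
  proof (intro exI[of _ "L + 1"] conjI allI)
    have wl': "\<bar>w x - w y\<bar> \<le> (L + 1) * norm (x - y)" for x y
      using wl[of x y] by (simp add: distrib_right add_increasing2)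
    then show "\<bar>w x - w y\<bar> \<le> (L + 1) * norm (x - y)" for x y .
    show "\<bar>w x\<bar> \<le> (L + 1) * norm x" for x using wl'[of x 0] w0 by simp
  qed (use L in simp)
  ultimately show ?thesis unfolding viscosity_solution_def by blast
qed

end
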